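(* Let $G$ be any Cayley graph of any finitely generated group. Then: (1) the domino problem on $G$ is Turing-equivalent to $\{f : F_{G,f}\models \exists x,\ x\to x\}$; (2) the seeded domino problem on $G$ is Turing-equivalent to $\{f : F_{G,f}\models \exists x\exists y,\ x\to x\wedge y\to x\wedge x\neq y\}$; (3) the recurring domino problem on $G$ is Turing-equivalent to $\{f : F_{G,f}\models \exists x\exists y,\ x\to x\wedge y\to x\wedge \neg(x\overset{\infty}{=}y)\}$, where $f$ ranges over CA local rules for $G$.
   Context: The Cayley graph of a finitely generated group $\Gamma$ with finite generating set $\Delta$ (closed under inverses) has vertex set $V=\Gamma$, a single vertex label, and $E_\delta=\{(\gamma,\gamma\delta):\gamma\in\Gamma\}$ for $\delta\in\Delta$. For $v\in V$ and $w=w_1\cdots w_k\in\Delta^*$, $\mathcal R^w(v)$ is the set of vertices $u$ for which there are $v=v_1,\dots,v_{k+1}=u$ with $(v_i,v_{i+1})\in E_{w_i}$; $\mathcal R^\epsilon(v)=\{v\}$. For a finite set $X$ and $k\ge1$, $\mathrm{MS}^k(X)=\{0,\dots,k\}^X$. For a finite state set $S$, $c\in S^V$, $v\in V$, $r\ge0$, $k\ge1$, $P(c,v,r,k)\in\mathrm{MS}^k(\Delta^{\le r}\times S)$ is $(w,s)\mapsto\min(k,\#\{v'\in\mathcal R^w(v):c_{v'}=s\})$, where $\Delta^{\le r}$ is the set of words of length at most $r$. A CA local rule with state set $S$, radius $r$, using $k$-capped multisets is a map $f:\mathrm{MS}^k(\Delta^{\le r}\times S)\to S$; its global map is $F_{G,f}(c)_v=f(P(c,v,r,k))$.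 FO formulas over CA orbits have variables ranging over configurations, atomic formulas $y=y'$ and $y\to y'$ (meaning $F(y)=y'$); in (3) the signature is extended by the relation $y\overset{\infty}{=}y'$, which holds iff $\{v: y_v\neq y'_v\}$ is finite. A domino specification over a finite set $S$ is a family $\mathcal D=(D_\delta)_{\delta\in\Delta}$ with $D_\delta\subseteq S\times S$; a configuration $c\in S^V$ is $\mathcal D$-valid if $(v,v')\in E_\delta$ implies $(c_v,c_{v'})\in D_\delta$. Domino problem: given $(S,\mathcal D)$, decide whether a $\mathcal D$-valid configuration exists. Seeded domino problem: given $(S,\mathcal D,s_0)$ with $s_0\in S$, decide whether a $\mathcal D$-valid configuration in which $s_0$ occurs at some vertex exists. Recurring domino problem: given $(S,\mathcal D,s_0)$, decide whether a $\mathcal D$-valid configuration in which $s_0$ occurs at infinitely many vertices exists. *)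

theory Defs
  imports "HOL-Algebra.Generated_Groups" "HOL-Library.Nat_Bijection"
begin

datatype recf = Zero | Succ | Proj nat | Comp recf "recf list" | Prim recf recf | Mn recf | Oracle

definition arg0 :: "nat list \<Rightarrow> nat" where
  "arg0 xs = (if xs = [] then 0 else hd xs)"

inductive eval :: "nat set \<Rightarrow> recf \<Rightarrow> nat list \<Rightarrow> nat \<Rightarrow> bool" for A where
  ev_zero: "eval A Zero xs 0"
| ev_succ: "eval A Succ xs (Suc (arg0 xs))"
| ev_proj: "i < length xs \<Longrightarrow> eval A (Proj i) xs (xs ! i)"
| ev_comp: "length ys = length gs \<Longrightarrow> (\<forall>i < length gs. eval A (gs ! i) xs (ys ! i))
            \<Longrightarrow> eval A f ys z \<Longrightarrow> eval A (Comp f gs) xs z"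
| ev_prim0: "eval A f xs y \<Longrightarrow> eval A (Prim f g) (0 # xs) y"
| ev_primS: "eval A (Prim f g) (n # xs) r \<Longrightarrow> eval A g (n # r # xs) y
            \<Longrightarrow> eval A (Prim f g) (Suc n # xs) y"
| ev_mn: "eval A f (n # xs) 0 \<Longrightarrow> (\<forall>m<n. \<exists>y. eval A f (m # xs) y \<and> y \<noteq> 0)
            \<Longrightarrow> eval A (Mn f) xs n"
| ev_oracle: "eval A Oracle xs (if arg0 xs \<in> A then 1 else 0)"

definition turing_reducible :: "nat set \<Rightarrow> nat set \<Rightarrow> bool" where
  "turing_reducible A B \<longleftrightarrow>
     (\<exists>p. \<forall>x y. eval B p [x] y \<longleftrightarrow> y = (if x \<in> A then 1 else 0))"

definition turing_equivalent :: "nat set \<Rightarrow> nat set \<Rightarrow> bool" where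
  "turing_equivalent A B \<longleftrightarrow> turing_reducible A B \<and> turing_reducible B A"

definition cayley_edge :: "('a, 'b) monoid_scheme \<Rightarrow> 'a list \<Rightarrow> nat \<Rightarrow> ('a \<times> 'a) set" where
  "cayley_edge G gens i = {(g, g \<otimes>\<^bsub>G\<^esub> (gens ! i)) | g. g \<in> carrier G}"

definition is_cayley_graph :: "('a, 'b) monoid_scheme \<Rightarrow> 'a list \<Rightarrow> bool" where
  "is_cayley_graph G gens \<longleftrightarrow> group G \<and> distinct gens \<and> set gens \<subseteq> carrier G
     \<and> generate G (set gens) = carrier G \<and> (\<forall>g \<in> set gens. inv\<^bsub>G\<^esub> g \<in> set gens)"

fun reach :: "('a, 'b) monoid_scheme \<Rightarrow> 'a list \<Rightarrow> nat list \<Rightarrow> 'a \<Rightarrow> 'a set" where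
  "reach G gens [] v = {v}"
| "reach G gens (i # w) v = \<Union> {reach G gens w u | u. (v, u) \<in> cayley_edge G gens i}"

definition dom_D :: "nat \<Rightarrow> nat \<Rightarrow> (nat \<times> nat) set" where
  "dom_D code i = (let ds = list_decode code in
     if i < length ds then set (map prod_decode (list_decode (ds ! i))) else {})"

definition domino_valid :: "('a, 'b) monoid_scheme \<Rightarrow> 'a list \<Rightarrow> nat \<Rightarrow> (nat \<Rightarrow> (nat \<times> nat) set)
   \<Rightarrow> ('a \<Rightarrow> nat) \<Rightarrow> bool" where
  "domino_valid G gens n D c \<longleftrightarrow> (\<forall>v \<in> carrier G. c v < n) \<and>
     (\<forall>i < length gens. \<forall>(v, v') \<in> cayley_edge G gens i. (c v, c v') \<in> D i)"

definition domino_problem :: "('a, 'b) monoid_scheme \<Rightarrow> 'a list \<Rightarrow> nat set" where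
  "domino_problem G gens = {code. case prod_decode code of (n, d) \<Rightarrow>
     (\<exists>c. domino_valid G gens n (dom_D d) c)}"

definition seeded_domino_problem :: "('a, 'b) monoid_scheme \<Rightarrow> 'a list \<Rightarrow> nat set" where
  "seeded_domino_problem G gens = {code. case prod_decode code of (n, x) \<Rightarrow>
     (case prod_decode x of (d, s0) \<Rightarrow>
       (\<exists>c. domino_valid G gens n (dom_D d) c \<and> (\<exists>v \<in> carrier G. c v = s0)))}"

definition recurring_domino_problem :: "('a, 'b) monoid_scheme \<Rightarrow> 'a list \<Rightarrow> nat set" where
  "recurring_domino_problem G gens = {code. case prod_decode code of (n, x) \<Rightarrow>
     (case prod_decode x of (d, s0) \<Rightarrow>
       (\<exists>c. domino_valid G gens n (dom_D d) c \<and> infinite {v \<in> carrier G. c v = s0}))}"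

definition ca_words :: "nat \<Rightarrow> nat \<Rightarrow> nat list list" where
  "ca_words d r = concat (map (\<lambda>l. List.n_lists l [0..<d]) [0..<Suc r])"

text \<open>P(c,v,r,k), a k-capped multiset, i.e. a function on Delta^{<=r} x S.\<close>
definition pattern :: "('a, 'b) monoid_scheme \<Rightarrow> 'a list \<Rightarrow> ('a \<Rightarrow> nat) \<Rightarrow> 'a \<Rightarrow> nat
    \<Rightarrow> nat list \<times> nat \<Rightarrow> nat" where
  "pattern G gens c v k ws = (case ws of (w, s) \<Rightarrow>
     min k (card {v' \<in> reach G gens w v. c v' = s}))"

definition radix :: "nat \<Rightarrow> nat list \<Rightarrow> nat" where
  "radix b ds = foldr (\<lambda>x acc. x + b * acc) ds 0"

text \<open>A local rule code is prod_encode (m0, prod_encode (r, prod_encode (k0, tcode))):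
  state set S = {0..<Suc m0}, radius r, cap k = Suc k0, and the rule is given by the
  lookup table list_decode tcode, indexed by the base-(k+1) number formed from the
  values of the multiset on Delta^{<=r} x S (in canonical order).  Every code denotes a
  local rule, and every local rule (state set {0..<m}, m>0) is denoted by some code.\<close>
definition ca_states :: "nat \<Rightarrow> nat" where
  "ca_states code = Suc (fst (prod_decode code))"

definition ca_radius :: "nat \<Rightarrow> nat" where
  "ca_radius code = fst (prod_decode (snd (prod_decode code)))"

definition ca_cap :: "nat \<Rightarrow> nat" where
  "ca_cap code = Suc (fst (prod_decode (snd (prod_decode (snd (prod_decode code))))))"

definition ca_table :: "nat \<Rightarrow> nat list" where
  "ca_table code = list_decode (snd (prod_decode (snd (prod_decode (snd (prod_decode code))))))"

definition local_rule :: "nat \<Rightarrow> nat \<Rightarrow> (nat list \<times> nat \<Rightarrow> nat) \<Rightarrow> nat" where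
  "local_rule d code P = (let m = ca_states code; r = ca_radius code; k = ca_cap code;
     tb = ca_table code;
     idx = radix (Suc k) (map P (List.product (ca_words d r) [0..<m]));
     t = (if idx < length tb then tb ! idx else 0)
   in if t < m then t else 0)"

definition ca_configs :: "('a, 'b) monoid_scheme \<Rightarrow> nat \<Rightarrow> ('a \<Rightarrow> nat) set" where
  "ca_configs G m = {c. (\<forall>v \<in> carrier G. c v < m) \<and> (\<forall>v. v \<notin> carrier G \<longrightarrow> c v = 0)}"

definition ca_global :: "('a, 'b) monoid_scheme \<Rightarrow> 'a list \<Rightarrow> nat \<Rightarrow> ('a \<Rightarrow> nat) \<Rightarrow> ('a \<Rightarrow> nat)" where
  "ca_global G gens code c = (\<lambda>v. if v \<in> carrier G then
      local_rule (length gens) code (pattern G gens c v (ca_cap code)) else 0)"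

definition ca_fixpoint_set :: "('a, 'b) monoid_scheme \<Rightarrow> 'a list \<Rightarrow> nat set" where
  "ca_fixpoint_set G gens = {code. \<exists>x \<in> ca_configs G (ca_states code).
      ca_global G gens code x = x}"

definition ca_preimage_set :: "('a, 'b) monoid_scheme \<Rightarrow> 'a list \<Rightarrow> nat set" where
  "ca_preimage_set G gens = {code. \<exists>x \<in> ca_configs G (ca_states code).
      \<exists>y \<in> ca_configs G (ca_states code).
      ca_global G gens code x = x \<and> ca_global G gens code y = x \<and> x \<noteq> y}"

definition ca_inf_preimage_set :: "('a, 'b) monoid_scheme \<Rightarrow> 'a list \<Rightarrow> nat set" where
  "ca_inf_preimage_set G gens = {code. \<exists>x \<in> ca_configs G (ca_states code).
      \<exists>y \<in> ca_configs G (ca_states code).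
      ca_global G gens code x = x \<and> ca_global G gens code y = x \<and>
      \<not> finite {v. x v \<noteq> y v}}"

end

theory Submission
  imports Defs
begin

text \<open>All reductions are primitive recursive, up to one bounded disjunction over oracle answers, and
  none of them needs the word problem of the group.

  From a domino specification on n tiles with seed tile s we build a radius 1 automaton with three
  additional states: a copy of s, which is read as s, and two error states. A vertex whose
  neighbourhood satisfies the specification writes its own tile, turning the copy back into s; any
  other vertex writes an error state. Fixed points are then exactly the valid configurations, and the
  preimages of a fixed point arise from it by replacing some occurrences of s by the copy.

  From an automaton of radius r we build tiles listing the states of a pair (x, y) of configurations
  along all words of length at most r. Neighbouring tiles must agree on their common words, and each
  tile must be consistent with x and y both being mapped to x. In such a tiling the states of x and y
  at the central positions determine all other entries, because the word i w read at v is the word w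
  read at the i-th neighbour of v. The configurations differ, or differ infinitely often, iff one of
  the finitely many tiles with different central states occurs, or occurs infinitely often.\<close>

section \<open>Closure properties of relative computability\<close>

inductive_cases eval_ZeroE: "eval B Zero xs y"
inductive_cases eval_SuccE: "eval B Succ xs y"
inductive_cases eval_ProjE: "eval B (Proj i) xs y"
inductive_cases eval_CompE: "eval B (Comp f gs) xs y"
inductive_cases eval_Prim0E: "eval B (Prim f g) (0 # xs) y"
inductive_cases eval_PrimSE: "eval B (Prim f g) (Suc n # xs) y"
inductive_cases eval_OracleE: "eval B Oracle xs y"

text \<open>The equivalence demands totality and uniqueness of the value at once, so determinism of
  \<open>eval\<close> travels along with every closure lemma.\<close>

definition computable_n :: "nat set \<Rightarrow> nat \<Rightarrow> (nat list \<Rightarrow> nat) \<Rightarrow> bool" where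
  "computable_n B n f \<longleftrightarrow> (\<exists>p. \<forall>xs. length xs = n \<longrightarrow> (\<forall>y. eval B p xs y \<longleftrightarrow> y = f xs))"

lemma computable_n_cong:
  "computable_n B n f \<Longrightarrow> (\<And>xs. length xs = n \<Longrightarrow> f xs = g xs) \<Longrightarrow> computable_n B n g"
  unfolding computable_n_def by metis

lemma computable_n_0: "computable_n B n (\<lambda>xs. 0)"
  unfolding computable_n_def by (rule exI[of _ Zero]) (auto elim: eval_ZeroE intro: ev_zero)

lemma computable_n_nth: "i < n \<Longrightarrow> computable_n B n (\<lambda>xs. xs ! i)"
  unfolding computable_n_def
  by (rule exI[of _ "Proj i"]) (auto elim: eval_ProjE intro: ev_proj)

lemma computable_n_comp:
  assumes "computable_n B (length fs) F" and "\<And>f. f \<in> set fs \<Longrightarrow> computable_n B n f"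
  shows "computable_n B n (\<lambda>xs. F (map (\<lambda>f. f xs) fs))"
proof -
  obtain p where p: "\<And>xs y. length xs = length fs \<Longrightarrow> eval B p xs y \<longleftrightarrow> y = F xs"
    using assms(1) unfolding computable_n_def by blast
  have "\<forall>f\<in>set fs. \<exists>q. \<forall>xs. length xs = n \<longrightarrow> (\<forall>y. eval B q xs y \<longleftrightarrow> y = f xs)"
    using assms(2) unfolding computable_n_def by blast
  then obtain q where q: "\<And>f xs y. f \<in> set fs \<Longrightarrow> length xs = n \<Longrightarrow> eval B (q f) xs y \<longleftrightarrow> y = f xs"
    by metis
  have "eval B (Comp p (map q fs)) xs y \<longleftrightarrow> y = F (map (\<lambda>f. f xs) fs)" if len: "length xs = n" for xs y
  proof
    assume "eval B (Comp p (map q fs)) xs y"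
    then obtain ys where ys: "length ys = length fs" "\<forall>i<length fs. eval B (q (fs ! i)) xs (ys ! i)"
      and e: "eval B p ys y" by (auto elim!: eval_CompE)
    have "ys = map (\<lambda>f. f xs) fs"
      by (rule nth_equalityI) (use ys q len in auto)
    then show "y = F (map (\<lambda>f. f xs) fs)" using e p by simp
  next
    assume y: "y = F (map (\<lambda>f. f xs) fs)"
    show "eval B (Comp p (map q fs)) xs y"
      by (rule ev_comp[of "map (\<lambda>f. f xs) fs"]) (use y p q len in auto)
  qed
  then show ?thesis unfolding computable_n_def by blast
qed

lemma computable_n_comp1:
  assumes "computable_n B 1 (\<lambda>xs. F (xs ! 0))" "computable_n B n f"
  shows "computable_n B n (\<lambda>xs. F (f xs))"
  using computable_n_comp[of B "[f]" "\<lambda>xs. F (xs ! 0)" n] assms by simp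

lemma computable_n_Suc: "computable_n B n f \<Longrightarrow> computable_n B n (\<lambda>xs. Suc (f xs))"
proof (rule computable_n_comp1[where F = Suc])
  show "computable_n B 1 (\<lambda>xs. Suc (xs ! 0))"
    unfolding computable_n_def
  proof (intro exI[of _ Succ] allI impI)
    fix xs :: "nat list" and y assume "length xs = 1"
    then have "arg0 xs = xs ! 0" by (cases xs) (auto simp: arg0_def)
    then show "eval B Succ xs y \<longleftrightarrow> y = Suc (xs ! 0)"
      by (metis eval_SuccE ev_succ)
  qed
qed

lemma computable_n_oracle:
  "computable_n B n f \<Longrightarrow> computable_n B n (\<lambda>xs. of_bool (f xs \<in> B))"
proof (rule computable_n_comp1[where F = "\<lambda>x. of_bool (x \<in> B)"])
  show "computable_n B 1 (\<lambda>xs. of_bool (xs ! 0 \<in> B))"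
    unfolding computable_n_def
  proof (intro exI[of _ Oracle] allI impI)
    fix xs :: "nat list" and y assume "length xs = 1"
    then have "arg0 xs = xs ! 0" by (cases xs) (auto simp: arg0_def)
    then show "eval B Oracle xs y \<longleftrightarrow> y = of_bool (xs ! 0 \<in> B)"
      by (metis (full_types) ev_oracle eval_OracleE of_bool_def)
  qed
qed

lemma computable_n_prim:
  assumes "computable_n B n f" "computable_n B (Suc (Suc n)) g"
  shows "computable_n B (Suc n) (\<lambda>xs. rec_nat (f (tl xs)) (\<lambda>k r. g (k # r # tl xs)) (hd xs))"
proof -
  obtain p where p: "\<And>xs y. length xs = n \<Longrightarrow> eval B p xs y \<longleftrightarrow> y = f xs"
    using assms(1) unfolding computable_n_def by blast
  obtain q where q: "\<And>xs y. length xs = Suc (Suc n) \<Longrightarrow> eval B q xs y \<longleftrightarrow> y = g xs"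
    using assms(2) unfolding computable_n_def by blast
  have *: "eval B (Prim p q) (k # xs) y \<longleftrightarrow> y = rec_nat (f xs) (\<lambda>k r. g (k # r # xs)) k"
    if len: "length xs = n" for k xs y
  proof (induction k arbitrary: y)
    case 0
    show ?case using p[OF len] by (auto elim: eval_Prim0E intro: ev_prim0)
  next
    case (Suc k)
    have q': "eval B q (k # r # xs) y \<longleftrightarrow> y = g (k # r # xs)" for r y
      using q[of "k # r # xs"] len by simp
    show ?case
    proof
      assume "eval B (Prim p q) (Suc k # xs) y"
      then show "y = rec_nat (f xs) (\<lambda>k r. g (k # r # xs)) (Suc k)"
        by (rule eval_PrimSE) (use Suc q' in auto)
    next
      assume "y = rec_nat (f xs) (\<lambda>k r. g (k # r # xs)) (Suc k)"
      then show "eval B (Prim p q) (Suc k # xs) y"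
        using Suc q' by (auto intro!: ev_primS)
    qed
  qed
  have "eval B (Prim p q) xs y \<longleftrightarrow> y = rec_nat (f (tl xs)) (\<lambda>k r. g (k # r # tl xs)) (hd xs)"
    if "length xs = Suc n" for xs y
    using *[of "tl xs" "hd xs" y] that by (cases xs) auto
  then show ?thesis unfolding computable_n_def by blast
qed

text \<open>\<open>Prim\<close> takes its bound from the head of the argument list; composing with
  \<open>h\<close> followed by all projections permits an arbitrary computable bound while the
  parameters stay in place.\<close>

lemma computable_n_rec:
  assumes "computable_n B n f" "computable_n B (Suc (Suc n)) g" "computable_n B n h"
  shows "computable_n B n (\<lambda>xs. rec_nat (f xs) (\<lambda>k r. g (k # r # xs)) (h xs))"
proof (rule computable_n_cong)
  let ?F = "\<lambda>xs. rec_nat (f (tl xs)) (\<lambda>k r. g (k # r # tl xs)) (hd xs)"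
  let ?fs = "h # map (\<lambda>i xs. xs ! i) [0..<n]"
  show "computable_n B n (\<lambda>xs. ?F (map (\<lambda>f. f xs) ?fs))"
    by (rule computable_n_comp) (use computable_n_prim[OF assms(1,2)] assms(3) in
        \<open>auto intro: computable_n_nth\<close>)
  show "?F (map (\<lambda>f. f xs) ?fs) = rec_nat (f xs) (\<lambda>k r. g (k # r # xs)) (h xs)"
    if "length xs = n" for xs
  proof -
    have "map (\<lambda>f. f xs) (map (\<lambda>i xs. xs ! i) [0..<n]) = xs"
      using that map_nth[of xs] by (simp add: comp_def)
    then show ?thesis by simp
  qed
qed

lemma computable_n_add:
  assumes "computable_n B n f" "computable_n B n g"
  shows "computable_n B n (\<lambda>xs. f xs + g xs)"
proof -
  have "rec_nat a (\<lambda>k r. Suc r) b = a + b" for a b :: nat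
    by (induction b) simp_all
  then show ?thesis
    using computable_n_rec[OF assms(1) computable_n_Suc[OF computable_n_nth[of 1]] assms(2)] by simp
qed

lemma computable_n_diff:
  assumes "computable_n B n f" "computable_n B n g"
  shows "computable_n B n (\<lambda>xs. f xs - g xs)"
proof -
  \<comment> \<open>The predecessor comes from a recursion returning its own counter; truncated
    subtraction then iterates it.\<close>
  have "rec_nat 0 (\<lambda>k r. k) b = b - 1" for b :: nat
    by (cases b) simp_all
  then have pred: "computable_n B n' h \<Longrightarrow> computable_n B n' (\<lambda>xs. h xs - 1)" for n' h
    using computable_n_rec[OF computable_n_0 computable_n_nth[of 0], where h = h] by simp
  have "rec_nat a (\<lambda>k r. r - 1) b = a - b" for a b :: nat
    by (induction b) simp_all
  then show ?thesis
    using computable_n_rec[OF assms(1) pred[OF computable_n_nth[of 1]] assms(2)] by simp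
qed

lemma computable_n_triangle:
  assumes "computable_n B n f"
  shows "computable_n B n (\<lambda>xs. triangle (f xs))"
proof -
  have "rec_nat 0 (\<lambda>k r. r + Suc k) b = triangle b" for b :: nat
    by (induction b) simp_all
  moreover have "computable_n B (Suc (Suc n)) (\<lambda>ys. ys ! 1 + Suc (ys ! 0))"
    by (intro computable_n_add computable_n_Suc computable_n_nth) simp_all
  ultimately show ?thesis
    using computable_n_rec[OF computable_n_0 _ assms] by fastforce
qed

text \<open>The diagonal a + b of a Cantor pair is recovered from its code by counting the triangular
  numbers that do not exceed it; this makes unpairing primitive recursive.\<close>

definition diagonal :: "nat \<Rightarrow> nat" where
  "diagonal z = rec_nat 0 (\<lambda>k r. r + (1 - (triangle (Suc k) - z))) z"

lemma diagonal_prod_encode: "diagonal (prod_encode (a, b)) = a + b"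
proof -
  let ?z = "triangle (a + b) + a"
  have mono: "triangle i \<le> triangle j" if "i \<le> j" for i j
    using that by (induction rule: dec_induct) simp_all
  \<comment> \<open>The recursion in \<open>diagonal\<close> runs \<open>?z\<close> rounds; this
    bound guarantees that at least \<open>a + b\<close> of them take place.\<close>
  have ge: "i \<le> triangle i" for i by (induction i) simp_all
  \<comment> \<open>Writing s for \<open>a + b\<close>, the code lies between
    \<open>triangle s\<close> and \<open>triangle (Suc s)\<close>, the latter excluded, so a round
    contributes 1 exactly while k < s.\<close>
  have step: "1 - (triangle (Suc k) - ?z) = of_bool (k < a + b)" for k
  proof (cases "k < a + b")
    case True
    then show ?thesis using mono[of "Suc k" "a + b"] by simp
  next
    case False
    then show ?thesis using mono[of "Suc (a + b)" "Suc k"] by simp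
  qed
  have "rec_nat 0 (\<lambda>k r. r + of_bool (k < s)) j = min s j" for s j :: nat
    by (induction j) auto
  then show ?thesis
    unfolding diagonal_def prod_encode_def step split using ge[of "a + b"] step by simp
qed

text \<open>The code of (a, b) is \<open>triangle (a + b) + a\<close>: removing the triangular part
  leaves a, and the diagonal minus a leaves b.\<close>

lemma fst_prod_decode: "fst (prod_decode z) = z - triangle (diagonal z)"
  and snd_prod_decode: "snd (prod_decode z) = diagonal z - fst (prod_decode z)"
proof -
  obtain a b where z: "z = prod_encode (a, b)"
    by (metis prod_decode_inverse surj_pair)
  show "fst (prod_decode z) = z - triangle (diagonal z)"
    "snd (prod_decode z) = diagonal z - fst (prod_decode z)"
    unfolding z diagonal_prod_encode by (simp_all, simp add: prod_encode_def)
qed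

lemma computable_n_diagonal:
  assumes "computable_n B n f"
  shows "computable_n B n (\<lambda>xs. diagonal (f xs))"
proof (rule computable_n_comp1[OF _ assms])
  have "computable_n B (Suc (Suc 1)) (\<lambda>ys. ys ! 1 + (Suc 0 - (triangle (Suc (ys ! 0)) - ys ! 2)))"
    by (intro computable_n_add computable_n_diff computable_n_triangle computable_n_Suc
        computable_n_nth computable_n_0) simp_all
  from computable_n_rec[OF computable_n_0 this computable_n_nth[of 0]]
  show "computable_n B 1 (\<lambda>xs. diagonal (xs ! 0))"
    by (simp add: diagonal_def[abs_def])
qed

section \<open>Unary computable functions and decidable predicates\<close>

definition computable :: "nat set \<Rightarrow> (nat \<Rightarrow> nat) \<Rightarrow> bool" where
  "computable B f \<longleftrightarrow> computable_n B 1 (\<lambda>xs. f (xs ! 0))"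

definition decidable :: "nat set \<Rightarrow> (nat \<Rightarrow> bool) \<Rightarrow> bool" where
  "decidable B P \<longleftrightarrow> computable B (\<lambda>x. of_bool (P x))"

text \<open>Turns a reduction into a decidability goal, which the rules collected in
  \<open>comp_intros\<close> prove by following the syntax of the predicate.\<close>

lemma turing_reducible_iff_decidable: "turing_reducible A B \<longleftrightarrow> decidable B (\<lambda>x. x \<in> A)"
proof -
  have "(\<forall>xs::nat list. length xs = 1 \<longrightarrow> P xs) \<longleftrightarrow> (\<forall>x. P [x])" for P
    by (metis One_nat_def length_0_conv length_Cons length_Suc_conv)
  then show ?thesis
    unfolding turing_reducible_def decidable_def computable_def computable_n_def of_bool_def
    by simp
qed

lemma computable_comp: "computable B f \<Longrightarrow> computable B g \<Longrightarrow> computable B (\<lambda>x. f (g x))"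
  unfolding computable_def by (rule computable_n_comp1)

named_theorems comp_intros

lemma computable_id [comp_intros]: "computable B (\<lambda>x. x)"
  unfolding computable_def by (rule computable_n_nth) simp

lemma computable_Suc [comp_intros]: "computable B f \<Longrightarrow> computable B (\<lambda>x. Suc (f x))"
  unfolding computable_def by (rule computable_n_Suc)

lemma computable_const [comp_intros]: "computable B (\<lambda>x. c)"
proof (induction c)
  case 0
  show ?case unfolding computable_def by (rule computable_n_0)
qed (rule computable_Suc)

lemma computable_add [comp_intros]:
  "computable B f \<Longrightarrow> computable B g \<Longrightarrow> computable B (\<lambda>x. f x + g x)"
  unfolding computable_def by (rule computable_n_add)

lemma computable_diff [comp_intros]:
  "computable B f \<Longrightarrow> computable B g \<Longrightarrow> computable B (\<lambda>x. f x - g x)"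
  unfolding computable_def by (rule computable_n_diff)

lemma computable_fst [comp_intros]:
  "computable B f \<Longrightarrow> computable B (\<lambda>x. fst (prod_decode (f x)))"
  unfolding computable_def fst_prod_decode
  by (intro computable_n_diff computable_n_triangle computable_n_diagonal)

lemma computable_snd [comp_intros]:
  "computable B f \<Longrightarrow> computable B (\<lambda>x. snd (prod_decode (f x)))"
  unfolding computable_def snd_prod_decode fst_prod_decode
  by (intro computable_n_diff computable_n_triangle computable_n_diagonal)

lemma computable_pair [comp_intros]:
  "computable B f \<Longrightarrow> computable B g \<Longrightarrow> computable B (\<lambda>x. prod_encode (f x, g x))"
  unfolding computable_def prod_encode_def split
  by (intro computable_n_add computable_n_triangle)

lemma computable_comp2:
  assumes "computable B (\<lambda>z. F (fst (prod_decode z)) (snd (prod_decode z)))"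
    and "computable B f" "computable B g"
  shows "computable B (\<lambda>x. F (f x) (g x))"
  using computable_comp[OF assms(1) computable_pair[OF assms(2,3)]] by simp

text \<open>The step function depends on x, k and r, so its computability is stated on codes of ((x,
  k), r); parameters may thus occur freely inside recursions.\<close>

lemma computable_rec:
  assumes f: "computable B f"
    and g: "computable B (\<lambda>z. g (fst (prod_decode (fst (prod_decode z))))
      (snd (prod_decode (fst (prod_decode z)))) (snd (prod_decode z)))"
    and h: "computable B h"
  shows "computable B (\<lambda>x. rec_nat (f x) (\<lambda>k r. g x k r) (h x))"
proof -
  let ?g = "\<lambda>ys. prod_encode (prod_encode (ys ! 2, ys ! 0), ys ! 1)"
  have "computable_n B (Suc (Suc 1)) ?g"
    unfolding prod_encode_def split
    by (intro computable_n_add computable_n_triangle computable_n_nth) simp_all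
  from computable_n_comp1[OF g[unfolded computable_def] this]
  have "computable_n B (Suc (Suc 1)) (\<lambda>ys. g (ys ! 2) (ys ! 0) (ys ! 1))" by simp
  from computable_n_rec[OF f[unfolded computable_def] this h[unfolded computable_def]]
  show ?thesis unfolding computable_def by simp
qed

lemma computable_sum [comp_intros]:
  assumes "computable B (\<lambda>z. g (fst (prod_decode z)) (snd (prod_decode z)))" "computable B h"
  shows "computable B (\<lambda>x. \<Sum>k<h x. g x k)"
proof -
  have "rec_nat 0 (\<lambda>k r. r + u k) b = (\<Sum>k<b. u k)" for b and u :: "nat \<Rightarrow> nat"
    by (induction b) simp_all
  moreover have "computable B (\<lambda>x. rec_nat 0 (\<lambda>k r. r + g x k) (h x))"
    by (intro computable_rec computable_add computable_comp2[OF assms(1)] comp_intros assms(2))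
  ultimately show ?thesis by simp
qed

lemma computable_mult [comp_intros]:
  "computable B f \<Longrightarrow> computable B g \<Longrightarrow> computable B (\<lambda>x. f x * g x)"
proof (rule computable_comp2[where F = "(*)"])
  show "computable B (\<lambda>z. fst (prod_decode z) * snd (prod_decode z))"
  proof -
    have "computable B (\<lambda>z. \<Sum>k<snd (prod_decode z). fst (prod_decode z))"
      by (intro comp_intros)
    then show ?thesis by (simp add: mult.commute)
  qed
qed

lemma computable_power [comp_intros]:
  "computable B f \<Longrightarrow> computable B g \<Longrightarrow> computable B (\<lambda>x. f x ^ g x)"
proof (rule computable_comp2[where F = "(^)"])
  have "rec_nat 1 (\<lambda>k r. a * r) b = a ^ b" for a b :: nat by (induction b) simp_all
  moreover have "computable B (\<lambda>z. rec_nat 1 (\<lambda>k r. fst (prod_decode z) * r) (snd (prod_decode z)))"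
    by (intro computable_rec comp_intros)
  ultimately show "computable B (\<lambda>z. fst (prod_decode z) ^ snd (prod_decode z))" by simp
qed

lemma computable_of_bool [comp_intros]: "decidable B P \<Longrightarrow> computable B (\<lambda>x. of_bool (P x))"
  unfolding decidable_def .

lemma decidable_le [comp_intros]:
  assumes "computable B f" "computable B g"
  shows "decidable B (\<lambda>x. f x \<le> g x)"
proof -
  have "of_bool (a \<le> b) = 1 - (a - b)" for a b :: nat by auto
  then show ?thesis unfolding decidable_def using assms by (simp only:) (intro comp_intros)
qed

lemma decidable_not [comp_intros]: "decidable B P \<Longrightarrow> decidable B (\<lambda>x. \<not> P x)"
proof -
  assume "decidable B P"
  then have "decidable B (\<lambda>x. of_bool (P x) \<le> (0 :: nat))" by (intro comp_intros)
  then show ?thesis by simp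
qed

lemma decidable_conj [comp_intros]:
  "decidable B P \<Longrightarrow> decidable B Q \<Longrightarrow> decidable B (\<lambda>x. P x \<and> Q x)"
  unfolding decidable_def of_bool_conj by (rule computable_mult)

lemma decidable_less [comp_intros]:
  "computable B f \<Longrightarrow> computable B g \<Longrightarrow> decidable B (\<lambda>x. f x < g x)"
  unfolding not_le[symmetric] by (intro comp_intros)

lemma decidable_eq [comp_intros]:
  "computable B f \<Longrightarrow> computable B g \<Longrightarrow> decidable B (\<lambda>x. f x = g x)"
  unfolding order_eq_iff by (intro comp_intros)

lemma decidable_disj [comp_intros]:
  assumes "decidable B P" "decidable B Q"
  shows "decidable B (\<lambda>x. P x \<or> Q x)"
proof -
  have "decidable B (\<lambda>x. \<not> (\<not> P x \<and> \<not> Q x))" using assms by (intro comp_intros)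
  then show ?thesis by simp
qed

lemma decidable_imp [comp_intros]:
  "decidable B P \<Longrightarrow> decidable B Q \<Longrightarrow> decidable B (\<lambda>x. P x \<longrightarrow> Q x)"
  unfolding imp_conv_disj by (intro comp_intros)

text \<open>Bounded search counts witnesses by a sum. \<open>P\<close> may itself query the oracle,
  as in the reductions from automata to dominoes.\<close>

lemma decidable_ex [comp_intros]:
  assumes "decidable B (\<lambda>z. P (fst (prod_decode z)) (snd (prod_decode z)))" "computable B h"
  shows "decidable B (\<lambda>x. \<exists>k<h x. P x k)"
proof -
  have "(\<exists>k<h x. P x k) \<longleftrightarrow> 0 < (\<Sum>k<h x. of_bool (P x k) :: nat)" for x
    by (auto simp: sum_eq_0_iff zero_less_iff_neq_zero simp del: sum_of_bool_eq)
  then show ?thesis using assms by (simp only:) (intro comp_intros)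
qed

lemma decidable_all [comp_intros]:
  assumes "decidable B (\<lambda>z. P (fst (prod_decode z)) (snd (prod_decode z)))" "computable B h"
  shows "decidable B (\<lambda>x. \<forall>k<h x. P x k)"
proof -
  have "decidable B (\<lambda>x. \<not> (\<exists>k<h x. \<not> P x k))" using assms by (intro comp_intros)
  then show ?thesis by simp
qed

lemma decidable_oracle [comp_intros]: "computable B f \<Longrightarrow> decidable B (\<lambda>x. f x \<in> B)"
  unfolding decidable_def computable_def by (rule computable_n_oracle)

lemma computable_if [comp_intros]:
  assumes "decidable B P" "computable B f" "computable B g"
  shows "computable B (\<lambda>x. if P x then f x else g x)"
proof -
  have "computable B (\<lambda>x. of_bool (P x) * f x + of_bool (\<not> P x) * g x)"
    using assms by (intro comp_intros)
  moreover have "of_bool p * a + of_bool (\<not> p) * b = (if p then a else b)" for p and a b :: nat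
    by simp
  ultimately show ?thesis by (simp only:)
qed

lemma computable_div [comp_intros]:
  "computable B f \<Longrightarrow> computable B g \<Longrightarrow> computable B (\<lambda>x. f x div g x)"
proof -
  assume *: "computable B f" "computable B g"
  \<comment> \<open>The quotient counts the positive multiples of b that are at most a; division by
    0 gives 0 and is treated apart.\<close>
  have "a div b = (if b = 0 then 0 else \<Sum>k<a. of_bool (b * Suc k \<le> a))" for a b :: nat
  proof (cases "b = 0")
    case False
    then have "b * Suc k \<le> a \<longleftrightarrow> k < a div b" for k
      using less_eq_div_iff_mult_less_eq[of b "Suc k" a] by (simp add: Suc_le_eq mult.commute)
    moreover have "{..<a} \<inter> {k. k < a div b} = {..<a div b}"
      using div_le_dividend[of a b] by (auto intro: order_less_le_trans)
    ultimately show ?thesis using False by simp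
  qed simp
  \<comment> \<open>Below the sum, \<open>f\<close> and \<open>g\<close> occur composed with the
    first projection of a pair code; the two \<open>computable_comp\<close> instances settle these
    goals.\<close>
  then show ?thesis using * by (simp only:) (intro comp_intros computable_comp[OF *(1)] computable_comp[OF *(2)])
qed

lemma computable_mod [comp_intros]:
  "computable B f \<Longrightarrow> computable B g \<Longrightarrow> computable B (\<lambda>x. f x mod g x)"
  unfolding minus_mult_div_eq_mod[symmetric] by (intro comp_intros)

section \<open>Computing with coded lists\<close>

text \<open>The code of a nonempty list is the successor of the pair of head and coded tail, so one
  round removes the head. The empty list has code 0 and stays 0, because
  \<open>prod_decode 0\<close> is (0, 0).\<close>

definition code_drop :: "nat \<Rightarrow> nat \<Rightarrow> nat" where
  "code_drop z i = rec_nat z (\<lambda>_ r. snd (prod_decode (r - 1))) i"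

definition code_nth :: "nat \<Rightarrow> nat \<Rightarrow> nat" where
  "code_nth z i = fst (prod_decode (code_drop z i - 1))"

lemma prod_decode_0: "prod_decode 0 = (0, 0)"
proof -
  have "prod_encode (0, 0) = 0" by (simp add: prod_encode_def)
  then show ?thesis by (metis prod_encode_inverse)
qed

lemma code_drop: "code_drop (list_encode xs) i = list_encode (drop i xs)"
proof (induction i)
  case (Suc i)
  have "code_drop (list_encode xs) (Suc i) = snd (prod_decode (list_encode (drop i xs) - 1))"
    using Suc by (simp add: code_drop_def)
  also have "\<dots> = list_encode (tl (drop i xs))"
    by (cases "drop i xs") (simp_all add: prod_decode_0)
  finally show ?case by (simp add: tl_drop drop_Suc)
qed (simp add: code_drop_def)

lemma code_drop_eq_0_iff: "code_drop z i = 0 \<longleftrightarrow> length (list_decode z) \<le> i"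
proof -
  have "code_drop z i = list_encode (drop i (list_decode z))"
    using code_drop[of "list_decode z" i] by simp
  moreover have "list_encode xs = 0 \<longleftrightarrow> xs = []" for xs by (cases xs) auto
  ultimately show ?thesis by simp
qed

lemma code_nth:
  "code_nth z i = (if i < length (list_decode z) then list_decode z ! i else 0)"
proof -
  have "code_drop z i = list_encode (drop i (list_decode z))"
    using code_drop[of "list_decode z" i] by simp
  then show ?thesis
    unfolding code_nth_def
    by (cases "drop i (list_decode z)") (auto simp: prod_decode_0 nth_via_drop)
qed

lemma length_list_decode_le: "length (list_decode z) \<le> z"
proof -
  have "length xs \<le> list_encode xs" for xs
  proof (induction xs)
    case (Cons x xs)
    then show ?case using le_prod_encode_2[of "list_encode xs" x] by simp
  qed simp
  from this[of "list_decode z"] show ?thesis by simp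
qed

lemma computable_code_drop [comp_intros]:
  "computable B f \<Longrightarrow> computable B g \<Longrightarrow> computable B (\<lambda>x. code_drop (f x) (g x))"
  by (rule computable_comp2[where F = code_drop]) (unfold code_drop_def, intro computable_rec comp_intros)

lemma computable_code_nth [comp_intros]:
  "computable B f \<Longrightarrow> computable B g \<Longrightarrow> computable B (\<lambda>x. code_nth (f x) (g x))"
  unfolding code_nth_def by (intro comp_intros)

lemma computable_list_encode [comp_intros]:
  assumes g: "computable B (\<lambda>z. g (fst (prod_decode z)) (snd (prod_decode z)))"
    and h: "computable B h"
  shows "computable B (\<lambda>x. list_encode (map (g x) [0..<h x]))"
proof -
  \<comment> \<open>The list is built from its end: after j rounds the accumulator codes the last j
    entries, hence the index \<open>b - Suc k\<close> in round k.\<close>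
  have *: "rec_nat 0 (\<lambda>k r. Suc (prod_encode (u (b - Suc k), r))) j = list_encode (map u [b - j..<b])"
    if "j \<le> b" for u b j
    using that
  proof (induction j)
    case (Suc j)
    then have "[b - Suc j..<b] = (b - Suc j) # [b - j..<b]"
      using upt_conv_Cons[of "b - Suc j" b] Suc_diff_Suc[of j b] by simp
    then show ?case using Suc by simp
  qed simp
  have "computable B (\<lambda>x. rec_nat 0 (\<lambda>k r. Suc (prod_encode (g x (h x - Suc k), r))) (h x))"
    by (intro computable_rec comp_intros computable_comp2[OF g] computable_comp[OF h] h)
  then show ?thesis using * by simp
qed

section \<open>Words, heap order and mixed digits\<close>

lemma radix_append: "radix b (xs @ ys) = radix b xs + b ^ length xs * radix b ys"
  by (induction xs) (simp_all add: radix_def algebra_simps)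

lemma radix_map_upt: "radix b (map f [0..<n]) = (\<Sum>i<n. f i * b ^ i)"
  by (induction n) (simp_all add: radix_append, simp_all add: radix_def)

lemma radix_less: "set xs \<subseteq> {..<b} \<Longrightarrow> radix b xs < b ^ length xs"
proof (induction xs)
  case (Cons x xs)
  then have "x + b * radix b xs < b + b * radix b xs" by simp
  also have "\<dots> = b * Suc (radix b xs)" by simp
  also have "\<dots> \<le> b * b ^ length xs"
    using Cons by (intro mult_le_mono) auto
  finally show ?case by (simp add: radix_def)
qed (simp add: radix_def)

lemma radix_digit: "set xs \<subseteq> {..<b} \<Longrightarrow> j < length xs \<Longrightarrow> radix b xs div b ^ j mod b = xs ! j"
proof (induction xs arbitrary: j)
  case (Cons x xs)
  then have *: "radix b (x # xs) div b = radix b xs" "radix b (x # xs) mod b = x"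
    by (auto simp: radix_def)
  show ?case
  proof (cases j)
    case (Suc i)
    then show ?thesis
      using Cons * by (simp add: div_mult2_eq)
  qed (use * in simp)
qed simp

text \<open>The number of words of length at most r over d letters.\<close>

fun heap_size :: "nat \<Rightarrow> nat \<Rightarrow> nat" where
  "heap_size d 0 = 1"
| "heap_size d (Suc r) = Suc (d * heap_size d r)"

text \<open>A position \<open>Suc q\<close> is split into its first letter and the position of the
  rest. For d = 0 only position 0, the empty word, lies below \<open>heap_size\<close>.\<close>

function heap_word :: "nat \<Rightarrow> nat \<Rightarrow> nat list" where
  "heap_word d 0 = []"
| "heap_word d (Suc q) = (q mod d) # heap_word d (q div d)"
  by pat_completeness auto
termination
  by (relation "measure snd") (auto simp: le_imp_less_Suc)

text \<open>The canonical enumeration of the words of length at most r is the breadth-first order of the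
  d-ary tree: prefixing a word by the letter i sends its position j to d j + i + 1.\<close>

lemma ca_words_Suc:
  "ca_words d (Suc r) = [] # concat (map (\<lambda>w. map (\<lambda>y. y # w) [0..<d]) (ca_words d r))"
proof -
  have "concat (map (\<lambda>l. List.n_lists (Suc l) [0..<d]) ls) =
      concat (map (\<lambda>w. map (\<lambda>y. y # w) [0..<d]) (concat (map (\<lambda>l. List.n_lists l [0..<d]) ls)))" for ls
    by (induction ls) simp_all
  moreover have "[0..<Suc (Suc r)] = 0 # map Suc [0..<Suc r]"
    by (simp add: map_Suc_upt upt_conv_Cons del: upt_Suc)
  ultimately show ?thesis
    unfolding ca_words_def by (simp add: comp_def del: upt_Suc)
qed

lemma ca_words_heap: "ca_words d r = map (heap_word d) [0..<heap_size d r]"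
proof (induction r)
  case 0
  show ?case by (simp add: ca_words_def)
next
  case (Suc r)
  \<comment> \<open>\<open>List.n_lists\<close> varies the first letter fastest, so prefixing
    letters to the word at position j fills the d consecutive positions \<open>d * j + 1\<close> to
    \<open>d * j + d\<close>.\<close>
  have *: "concat (map (\<lambda>j. map (\<lambda>y. y # heap_word d j) [0..<d]) [0..<n]) =
      map (\<lambda>q. heap_word d (Suc q)) [0..<d * n]" for n
  proof (induction n)
    case (Suc n)
    have "map (\<lambda>q. heap_word d (Suc q)) [d * n..<d * n + d] = map (\<lambda>y. y # heap_word d n) [0..<d]"
      by (rule nth_equalityI) auto
    moreover have "[0..<d * Suc n] = [0..<d * n] @ [d * n..<d * n + d]"
      by (metis add.commute le_add2 mult_Suc_right upt_add_eq_append zero_le)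
    ultimately show ?case using Suc by simp
  qed simp
  have "[0..<Suc (d * heap_size d r)] = 0 # map Suc [0..<d * heap_size d r]"
    by (simp add: map_Suc_upt upt_conv_Cons del: upt_Suc)
  then show ?case
    unfolding ca_words_Suc Suc using *[of "heap_size d r"] by (simp add: comp_def del: upt_Suc)
qed

lemma length_ca_words [simp]: "length (ca_words d r) = heap_size d r"
  by (simp add: ca_words_heap)

section \<open>Walks in the Cayley graph\<close>

locale cayley_graph =
  fixes G :: "('a, 'b) monoid_scheme" and gens :: "'a list"
  assumes cayley: "is_cayley_graph G gens"
begin

sublocale group G
  using cayley by (simp add: is_cayley_graph_def)

abbreviation deg :: nat where "deg \<equiv> length gens"

definition step :: "'a \<Rightarrow> nat \<Rightarrow> 'a" where "step v i = v \<otimes>\<^bsub>G\<^esub> gens ! i"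

fun walk :: "'a \<Rightarrow> nat list \<Rightarrow> 'a" where
  "walk v [] = v"
| "walk v (i # w) = walk (step v i) w"

definition heap_walk :: "'a \<Rightarrow> nat \<Rightarrow> 'a" where
  "heap_walk v j = walk v (heap_word deg j)"

lemma step_closed: "v \<in> carrier G \<Longrightarrow> i < deg \<Longrightarrow> step v i \<in> carrier G"
  using cayley nth_mem unfolding is_cayley_graph_def step_def by blast

text \<open>Each edge relation is the graph of right multiplication by a generator, so a word can be
  followed in one way only.\<close>

lemma reach_walk:
  "v \<in> carrier G \<Longrightarrow> set w \<subseteq> {..<deg} \<Longrightarrow> reach G gens w v = {walk v w} \<and> walk v w \<in> carrier G"
proof (induction w arbitrary: v)
  case (Cons i w)
  have "{u. (v, u) \<in> cayley_edge G gens i} = {step v i}"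
    using Cons.prems by (auto simp: cayley_edge_def step_def)
  then have "reach G gens (i # w) v = reach G gens w (step v i)"
    by (auto simp: set_eq_iff)
  then show ?case using Cons by (simp add: step_closed)
qed simp

lemma heap_walk_0 [simp]: "heap_walk v 0 = v"
  by (simp add: heap_walk_def)

text \<open>Position \<open>deg * j + i + 1\<close> holds the letter i followed by the word at
  position j. This is what turns overlap of tiles into a condition on single edges.\<close>

lemma heap_walk_child: "i < deg \<Longrightarrow> heap_walk v (Suc (deg * j + i)) = heap_walk (step v i) j"
proof -
  assume i: "i < deg"
  then have "(deg * j + i) div deg = j" by (intro div_nat_eqI) simp_all
  then show ?thesis using i by (simp add: heap_walk_def)
qed

lemma set_heap_word: "j < heap_size deg r \<Longrightarrow> set (heap_word deg j) \<subseteq> {..<deg}"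
proof (induction r arbitrary: j)
  case (Suc r)
  show ?case
  proof (cases j)
    case (Suc q)
    then have "q < deg * heap_size deg r" using Suc.prems by simp
    moreover from this have "q div deg < heap_size deg r" "0 < deg"
      by (auto simp: less_mult_imp_div_less mult.commute)
    ultimately show ?thesis using Suc.IH Suc by simp
  qed simp
qed simp

lemma reach_heap:
  assumes "v \<in> carrier G" "j < heap_size deg r"
  shows "reach G gens (heap_word deg j) v = {heap_walk v j}" "heap_walk v j \<in> carrier G"
  using reach_walk[OF assms(1) set_heap_word[OF assms(2)]] by (simp_all add: heap_walk_def)

lemma domino_valid_iff:
  "domino_valid G gens n D c \<longleftrightarrow> (\<forall>v \<in> carrier G. c v < n) \<and>
     (\<forall>v \<in> carrier G. \<forall>i < deg. (c v, c (step v i)) \<in> D i)"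
  by (auto simp: domino_valid_def cayley_edge_def step_def)

end

text \<open>The table index that \<open>local_rule\<close> computes when \<open>x j\<close> is the
  state seen along the j-th word: digit \<open>j * m + s\<close> indicates whether that state is
  s.\<close>

definition heap_index :: "nat \<Rightarrow> nat \<Rightarrow> nat \<Rightarrow> (nat \<Rightarrow> nat) \<Rightarrow> nat" where
  "heap_index b N m x = radix b (map (\<lambda>i. of_bool (x (i div m) = i mod m)) [0..<N * m])"

definition table_value :: "nat \<Rightarrow> nat \<Rightarrow> nat \<Rightarrow> nat" where
  "table_value m tcode idx = (if code_nth tcode idx < m then code_nth tcode idx else 0)"

text \<open>In a Cayley graph every word leads to exactly one vertex, so the capped multiset at v is the
  indicator of the states seen along the words, whatever the cap.\<close>

lemma (in cayley_graph) ca_global_heap: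
  assumes "v \<in> carrier G"
  shows "ca_global G gens code c v =
    table_value (ca_states code) (snd (prod_decode (snd (prod_decode (snd (prod_decode code))))))
      (heap_index (Suc (ca_cap code)) (heap_size deg (ca_radius code)) (ca_states code)
        (\<lambda>j. c (heap_walk v j)))"
proof -
  let ?m = "ca_states code" and ?N = "heap_size deg (ca_radius code)"
  let ?P = "pattern G gens c v (ca_cap code)"
  have "map ?P (List.product (ca_words deg (ca_radius code)) [0..<?m]) =
      map (\<lambda>i. of_bool (c (heap_walk v (i div ?m)) = i mod ?m)) [0..<?N * ?m]"
  proof (rule nth_equalityI)
    fix i assume "i < length (map ?P (List.product (ca_words deg (ca_radius code)) [0..<?m]))"
    then have i: "i < ?N * ?m" by simp
    then have m: "0 < ?m" "i div ?m < ?N"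
      by (auto simp: less_mult_imp_div_less ca_states_def)
    have "card {v' \<in> {heap_walk v j}. c v' = s} = of_bool (c (heap_walk v j) = s)" for j s
      by (cases "c (heap_walk v j) = s") (auto simp: Collect_conv_if)
    then show "map ?P (List.product (ca_words deg (ca_radius code)) [0..<?m]) ! i =
        map (\<lambda>i. of_bool (c (heap_walk v (i div ?m)) = i mod ?m)) [0..<?N * ?m] ! i"
      using i m reach_heap(1)[OF assms m(2)]
      by (simp add: List.product_nth ca_words_heap pattern_def ca_cap_def)
  qed simp
  then show ?thesis
    using assms unfolding ca_global_def local_rule_def heap_index_def table_value_def ca_table_def
      code_nth Let_def by simp
qed

section \<open>From domino specifications to cellular automata\<close>

text \<open>A nonzero \<open>code_drop\<close> tests that an index is in range, and the code of the
  inner list bounds the search because it bounds the length.\<close>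

lemma mem_dom_D_iff:
  "(a, b) \<in> dom_D d i \<longleftrightarrow> code_drop d i \<noteq> 0 \<and>
     (\<exists>j<code_nth d i. code_drop (code_nth d i) j \<noteq> 0 \<and> code_nth (code_nth d i) j = prod_encode (a, b))"
proof -
  have "(a, b) \<in> set (map prod_decode xs) \<longleftrightarrow> (\<exists>j<length xs. xs ! j = prod_encode (a, b))" for xs
    by (force simp: in_set_conv_nth)
  moreover have "j < z" if "j < length (list_decode z)" for j z
    using that length_list_decode_le[of z] by simp
  ultimately show ?thesis
    unfolding dom_D_def Let_def code_drop_eq_0_iff code_nth not_le by auto
qed

lemma decidable_dom_D [comp_intros]:
  assumes "computable B f" "computable B g" and d: "computable B d" "computable B i"
  shows "decidable B (\<lambda>x. (f x, g x) \<in> dom_D (d x) (i x))"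
  unfolding mem_dom_D_iff
  by (intro comp_intros assms computable_comp[OF assms(1)] computable_comp[OF assms(2)]
      computable_comp[OF assms(3)] computable_comp[OF assms(4)])

text \<open>With cap 1 the base is 2, and of the m bits belonging to word j exactly one is set,
  namely at the state seen; weighting the bits by s returns that state.\<close>

definition read_state :: "nat \<Rightarrow> nat \<Rightarrow> nat \<Rightarrow> nat" where
  "read_state idx m j = (\<Sum>s<m. s * (idx div 2 ^ (j * m + s) mod 2))"

lemma read_state_heap_index:
  assumes "j < N" "x j < m"
  shows "read_state (heap_index 2 N m x) m j = x j"
proof -
  have "s * (heap_index 2 N m x div 2 ^ (j * m + s) mod 2) = (if s = x j then x j else 0)" if s: "s < m" for s
  proof -
    have "j * m + s < Suc j * m" using s by simp
    also have "\<dots> \<le> N * m" using assms(1) by (intro mult_le_mono1) simp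
    finally have "j * m + s < N * m" .
    then have "heap_index 2 N m x div 2 ^ (j * m + s) mod 2 = of_bool (x j = s)"
      unfolding heap_index_def using s by (subst radix_digit) auto
    then show ?thesis by auto
  qed
  then have "read_state (heap_index 2 N m x) m j = (\<Sum>s<m. if s = x j then x j else 0)"
    unfolding read_state_def by (intro sum.cong) auto
  then show ?thesis using assms(2) by simp
qed

text \<open>Keeps every lookup inside a table of length \<open>2 ^ (N * m)\<close>, so the default
  for missing entries does not arise.\<close>

lemma heap_index_less:
  "heap_index 2 N m x < 2 ^ (N * m)"
proof -
  have "set (map (\<lambda>i. of_bool (x (i div m) = i mod m)) [0..<N * m]) \<subseteq> {..<2 :: nat}" by auto
  from radix_less[OF this] show ?thesis by (simp add: heap_index_def)
qed

text \<open>State n is a second copy of the seed tile; n + 1 and n + 2 are error states, which swap so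
  that neither a fixed point nor any of its preimages contains an error.\<close>

definition seed_proj :: "nat \<Rightarrow> nat \<Rightarrow> nat \<Rightarrow> nat" where
  "seed_proj n s0 a = (if a = n then s0 else a)"

text \<open>Position 0 is the vertex itself and \<open>Suc i\<close> its i-th neighbour. The test
  \<open>< n\<close> also rejects the copy when \<open>s0\<close> is not a tile.\<close>

definition tile_rule :: "nat \<Rightarrow> nat \<Rightarrow> nat \<Rightarrow> nat \<Rightarrow> (nat \<Rightarrow> nat) \<Rightarrow> nat" where
  "tile_rule k n d s0 x =
     (if seed_proj n s0 (x 0) < n \<and>
         (\<forall>i<k. (seed_proj n s0 (x 0), seed_proj n s0 (x (Suc i))) \<in> dom_D d i)
      then seed_proj n s0 (x 0)
      else if x 0 = Suc n then Suc (Suc n) else Suc n)"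

text \<open>The stored numbers \<open>n + 2\<close> and 0 stand for n + 3 states and cap 1. A table
  index has one bit for each state and each of the \<open>Suc k\<close> words of length at most
  1.\<close>

definition domino_ca :: "nat \<Rightarrow> nat \<Rightarrow> nat \<Rightarrow> nat \<Rightarrow> nat" where
  "domino_ca k n d s0 = prod_encode (n + 2, prod_encode (1, prod_encode (0,
     list_encode (map (\<lambda>idx. tile_rule k n d s0 (read_state idx (n + 3))) [0..<2 ^ (Suc k * (n + 3))]))))"

lemma computable_domino_ca:
  assumes "computable B n" "computable B d" "computable B s0"
  shows "computable B (\<lambda>x. domino_ca k (n x) (d x) (s0 x))"
  unfolding domino_ca_def tile_rule_def seed_proj_def read_state_def
  by (intro comp_intros assms computable_comp[OF assms(1)] computable_comp[OF assms(2)]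
      computable_comp[OF assms(3)])

lemma ca_states_domino_ca: "ca_states (domino_ca k n d s0) = n + 3"
  by (simp add: domino_ca_def ca_states_def)

section \<open>Fixed points and preimages of the tile automaton\<close>

context cayley_graph
begin

lemma ca_global_domino_ca:
  assumes v: "v \<in> carrier G" and c: "c \<in> ca_configs G (n + 3)"
  shows "ca_global G gens (domino_ca deg n d s0) c v =
    (if seed_proj n s0 (c v) < n \<and>
        (\<forall>i<deg. (seed_proj n s0 (c v), seed_proj n s0 (c (step v i))) \<in> dom_D d i)
     then seed_proj n s0 (c v)
     else if c v = Suc n then Suc (Suc n) else Suc n)"
proof -
  let ?x = "\<lambda>j. c (heap_walk v j)" and ?m = "n + 3" and ?code = "domino_ca deg n d s0"
  let ?idx = "heap_index 2 (Suc deg) ?m ?x"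
  let ?t = "tile_rule deg n d s0 (read_state ?idx ?m)"
  have child: "heap_walk v (Suc i) = step v i" if "i < deg" for i
    using heap_walk_child[OF that, of v 0] by simp
  have "read_state ?idx ?m j = ?x j" if "j < Suc deg" for j
    using that reach_heap(2)[OF v, of j 1] c by (intro read_state_heap_index) (simp_all add: ca_configs_def)
  then have rd: "read_state ?idx ?m 0 = c v" "\<And>i. i < deg \<Longrightarrow> read_state ?idx ?m (Suc i) = c (step v i)"
    using child by auto
  have params: "ca_states ?code = n + 3" "ca_radius ?code = 1" "ca_cap ?code = 1"
    "snd (prod_decode (snd (prod_decode (snd (prod_decode ?code))))) =
      list_encode (map (\<lambda>idx. tile_rule deg n d s0 (read_state idx ?m)) [0..<2 ^ (Suc deg * ?m)])"
    unfolding ca_states_def ca_radius_def ca_cap_def by (simp_all add: domino_ca_def del: upt_Suc)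
  have "heap_size deg 1 = Suc deg" "Suc 1 = 2" by simp_all
  then have "ca_global G gens ?code c v = (if ?t < ?m then ?t else 0)"
    using heap_index_less[of "Suc deg" ?m ?x]
    unfolding ca_global_heap[OF v] params by (simp only: table_value_def code_nth list_encode_inverse
        length_map length_upt nth_map nth_upt diff_zero add_0 if_True)
  also have "\<dots> = ?t"
    by (auto simp: tile_rule_def)
  also have "\<dots> = tile_rule deg n d s0 (\<lambda>j. if j = 0 then c v else c (step v (j - 1)))"
    using rd by (simp add: tile_rule_def)
  finally show ?thesis by (simp add: tile_rule_def)
qed

text \<open>A fixed point avoids the error branch, which changes every state, and avoids the copy,
  since a successful test writes a tile below n. A preimage of x then passes all tests too and
  projects onto x. Conversely, a y that projects onto a valid x is tested on the tiles of x.\<close>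

lemma fixed_preimage_iff:
  assumes "x \<in> ca_configs G (n + 3)" "y \<in> ca_configs G (n + 3)"
  shows "ca_global G gens (domino_ca deg n d s0) x = x \<and> ca_global G gens (domino_ca deg n d s0) y = x \<longleftrightarrow>
    domino_valid G gens n (dom_D d) x \<and> (\<forall>v\<in>carrier G. y v = x v \<or> y v = n \<and> x v = s0)"
    (is "?F x = x \<and> ?F y = x \<longleftrightarrow> ?R")
proof
  have out: "\<And>v. v \<notin> carrier G \<Longrightarrow> x v = 0"
    using assms by (auto simp: ca_configs_def)
  note F = ca_global_domino_ca[OF _ assms(1)] ca_global_domino_ca[OF _ assms(2)]
  {
    assume *: "?F x = x \<and> ?F y = x"
    have x: "x v < n \<and> (\<forall>i<deg. (x v, seed_proj n s0 (x (step v i))) \<in> dom_D d i)"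
      if "v \<in> carrier G" for v
    proof -
      have "?F x v = x v" using * by simp
      then show ?thesis
        unfolding F(1)[OF that] by (auto simp: seed_proj_def split: if_splits)
    qed
    have "seed_proj n s0 (x (step v i)) = x (step v i)" if "v \<in> carrier G" "i < deg" for v i
      using x[OF step_closed[OF that]] by (simp add: seed_proj_def)
    with x have "domino_valid G gens n (dom_D d) x"
      by (simp add: domino_valid_iff)
    moreover have "y v = x v \<or> y v = n \<and> x v = s0" if "v \<in> carrier G" for v
    proof -
      have "?F y v = x v" "x v < n" using * x that by auto
      then show ?thesis
        unfolding F(2)[OF that] by (auto simp: seed_proj_def split: if_splits)
    qed
    ultimately show ?R by blast
  next
    assume ?R
    then have x: "x v < n" "\<And>i. i < deg \<Longrightarrow> (x v, x (step v i)) \<in> dom_D d i"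
      and y: "y v = x v \<or> y v = n \<and> x v = s0" if "v \<in> carrier G" for v
      using that by (auto simp: domino_valid_iff)
    have proj: "seed_proj n s0 (x v) = x v" "seed_proj n s0 (y v) = x v" if "v \<in> carrier G" for v
      using x(1)[OF that] y[OF that] by (auto simp: seed_proj_def)
    have "?F x v = x v \<and> ?F y v = x v" for v
    proof (cases "v \<in> carrier G")
      case True
      then show ?thesis
        unfolding F(1)[OF True] F(2)[OF True] using x[OF True] by (simp add: proj step_closed)
    next
      case False
      then show ?thesis using out by (simp add: ca_global_def)
    qed
    then show "?F x = x \<and> ?F y = x" by auto
  }
qed

text \<open>\<open>domino_valid\<close> looks only at the carrier, while \<open>ca_configs\<close>
  requires the value 0 outside it.\<close>

lemma extensional_domino_config:
  assumes "domino_valid G gens n D c"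
  obtains x where "x \<in> ca_configs G (n + 3)" "domino_valid G gens n D x"
    "\<And>v. v \<in> carrier G \<Longrightarrow> x v = c v"
proof (rule that[of "\<lambda>v. if v \<in> carrier G then c v else 0"])
  show "(\<lambda>v. if v \<in> carrier G then c v else 0) \<in> ca_configs G (n + 3)"
    using assms by (fastforce simp: ca_configs_def domino_valid_iff)
  show "domino_valid G gens n D (\<lambda>v. if v \<in> carrier G then c v else 0)"
    using assms by (auto simp: domino_valid_iff step_closed)
qed simp

lemma domino_ca_fixpoint:
  "domino_ca deg n d s0 \<in> ca_fixpoint_set G gens \<longleftrightarrow> (\<exists>c. domino_valid G gens n (dom_D d) c)"
    (is "?L \<longleftrightarrow> ?R")
proof
  assume ?L
  then show ?R
    unfolding ca_fixpoint_set_def mem_Collect_eq ca_states_domino_ca using fixed_preimage_iff by blast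
next
  assume ?R
  then obtain x where x: "x \<in> ca_configs G (n + 3)" "domino_valid G gens n (dom_D d) x"
    using extensional_domino_config by metis
  then have "ca_global G gens (domino_ca deg n d s0) x = x"
    using fixed_preimage_iff[OF x(1) x(1), of d s0] by blast
  then show ?L
    unfolding ca_fixpoint_set_def mem_Collect_eq ca_states_domino_ca using x(1) by blast
qed

lemma toggle_seed:
  assumes "domino_valid G gens n (dom_D d) c"
  obtains x y where "x \<in> ca_configs G (n + 3)" "y \<in> ca_configs G (n + 3)"
    "ca_global G gens (domino_ca deg n d s0) x = x" "ca_global G gens (domino_ca deg n d s0) y = x"
    "{v. x v \<noteq> y v} = {v \<in> carrier G. c v = s0}"
proof -
  obtain x where x: "x \<in> ca_configs G (n + 3)" "domino_valid G gens n (dom_D d) x"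
    and c: "\<And>v. v \<in> carrier G \<Longrightarrow> x v = c v"
    using extensional_domino_config[OF assms] by metis
  \<comment> \<open>Every seed is replaced by the copy n; as x stays below n on the carrier, the two
    configurations differ exactly at the seeds.\<close>
  define y where "y = (\<lambda>v. if v \<in> carrier G \<and> x v = s0 then n else x v)"
  have y: "y \<in> ca_configs G (n + 3)"
    using x(1) by (simp add: ca_configs_def y_def)
  have "\<forall>v\<in>carrier G. y v = x v \<or> y v = n \<and> x v = s0" by (simp add: y_def)
  then have "ca_global G gens (domino_ca deg n d s0) x = x \<and> ca_global G gens (domino_ca deg n d s0) y = x"
    using fixed_preimage_iff[OF x(1) y, of d s0] x(2) by blast
  moreover have "x v < n" if "v \<in> carrier G" for v
    using x(2) that by (simp add: domino_valid_iff)
  then have "x v \<noteq> y v \<longleftrightarrow> v \<in> carrier G \<and> c v = s0" for v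
    by (cases "v \<in> carrier G") (auto simp: y_def simp flip: c)
  then have "{v. x v \<noteq> y v} = {v \<in> carrier G. c v = s0}" by simp
  ultimately show ?thesis using that x(1) y by blast
qed

text \<open>An inclusion is all one can expect, because a preimage may keep some seeds. It suffices:
  a nonempty or infinite set of differences forces the same for the seeds.\<close>

lemma differs_only_at_seeds:
  assumes x: "x \<in> ca_configs G (n + 3)" and y: "y \<in> ca_configs G (n + 3)"
    and "ca_global G gens (domino_ca deg n d s0) x = x" "ca_global G gens (domino_ca deg n d s0) y = x"
  shows "domino_valid G gens n (dom_D d) x" "{v. x v \<noteq> y v} \<subseteq> {v \<in> carrier G. x v = s0}"
proof -
  have *: "domino_valid G gens n (dom_D d) x" "\<forall>v\<in>carrier G. y v = x v \<or> y v = n \<and> x v = s0"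
    using fixed_preimage_iff[OF x y, of d s0] assms(3,4) by blast+
  then show "domino_valid G gens n (dom_D d) x" by blast
  have "x v = y v" if "v \<notin> carrier G" for v
    using that x y by (simp add: ca_configs_def)
  then have "v \<in> carrier G \<and> x v = s0" if "x v \<noteq> y v" for v
    using that *(2) by metis
  then show "{v. x v \<noteq> y v} \<subseteq> {v \<in> carrier G. x v = s0}" by blast
qed

lemma domino_ca_preimage:
  "domino_ca deg n d s0 \<in> ca_preimage_set G gens \<longleftrightarrow>
    (\<exists>c. domino_valid G gens n (dom_D d) c \<and> (\<exists>v\<in>carrier G. c v = s0))" (is "?L \<longleftrightarrow> ?R")
proof
  assume ?L
  then obtain x y where xy: "x \<in> ca_configs G (n + 3)" "y \<in> ca_configs G (n + 3)"
    "ca_global G gens (domino_ca deg n d s0) x = x" "ca_global G gens (domino_ca deg n d s0) y = x" "x \<noteq> y"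
    unfolding ca_preimage_set_def mem_Collect_eq ca_states_domino_ca by blast
  then obtain v where "x v \<noteq> y v" by blast
  then show ?R using differs_only_at_seeds[OF xy(1-4)] by blast
next
  assume ?R
  then obtain c v where "domino_valid G gens n (dom_D d) c" and v: "v \<in> carrier G" "c v = s0" by blast
  from toggle_seed[OF this(1), of s0] obtain x y where xy: "x \<in> ca_configs G (n + 3)"
    "y \<in> ca_configs G (n + 3)"
    "ca_global G gens (domino_ca deg n d s0) x = x" "ca_global G gens (domino_ca deg n d s0) y = x"
    "{v. x v \<noteq> y v} = {v \<in> carrier G. c v = s0}" by blast
  then have "x v \<noteq> y v" using v by blast
  then have "x \<noteq> y" by blast
  then show ?L
    unfolding ca_preimage_set_def mem_Collect_eq ca_states_domino_ca using xy by blast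
qed

lemma domino_ca_inf_preimage:
  "domino_ca deg n d s0 \<in> ca_inf_preimage_set G gens \<longleftrightarrow>
    (\<exists>c. domino_valid G gens n (dom_D d) c \<and> infinite {v \<in> carrier G. c v = s0})" (is "?L \<longleftrightarrow> ?R")
proof
  assume ?L
  then obtain x y where xy: "x \<in> ca_configs G (n + 3)" "y \<in> ca_configs G (n + 3)"
    "ca_global G gens (domino_ca deg n d s0) x = x" "ca_global G gens (domino_ca deg n d s0) y = x"
    and "infinite {v. x v \<noteq> y v}"
    unfolding ca_inf_preimage_set_def mem_Collect_eq ca_states_domino_ca by blast
  then show ?R using differs_only_at_seeds[OF xy] finite_subset by blast
next
  assume ?R
  then obtain c where "domino_valid G gens n (dom_D d) c" and inf: "infinite {v \<in> carrier G. c v = s0}"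
    by blast
  from toggle_seed[OF this(1), of s0] obtain x y where "x \<in> ca_configs G (n + 3)"
    "y \<in> ca_configs G (n + 3)"
    "ca_global G gens (domino_ca deg n d s0) x = x" "ca_global G gens (domino_ca deg n d s0) y = x"
    "{v. x v \<noteq> y v} = {v \<in> carrier G. c v = s0}" by blast
  then show ?L
    unfolding ca_inf_preimage_set_def mem_Collect_eq ca_states_domino_ca using inf by fastforce
qed

text \<open>One oracle query at the computed rule decides each problem. The plain problem has no
  seed, so 0 stands in as an arbitrary one.\<close>

lemma domino_problems_reduce:
  "turing_reducible (domino_problem G gens) (ca_fixpoint_set G gens)"
  "turing_reducible (seeded_domino_problem G gens) (ca_preimage_set G gens)"
  "turing_reducible (recurring_domino_problem G gens) (ca_inf_preimage_set G gens)"
  unfolding turing_reducible_iff_decidable domino_problem_def seeded_domino_problem_def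
    recurring_domino_problem_def mem_Collect_eq case_prod_unfold
    domino_ca_fixpoint[symmetric, of _ _ 0] domino_ca_preimage[symmetric]
    domino_ca_inf_preimage[symmetric]
  by (intro comp_intros computable_domino_ca)+

end

section \<open>From cellular automata to domino specifications\<close>

lemma heap_index_cong:
  assumes "\<And>j. j < N \<Longrightarrow> x j = y j"
  shows "heap_index b N m x = heap_index b N m y"
proof -
  have "x (i div m) = y (i div m)" if "i < N * m" for i
    using assms less_mult_imp_div_less[OF that] by simp
  then show ?thesis
    unfolding heap_index_def by (intro arg_cong[where f = "radix b"] map_cong) auto
qed

lemma computable_heap_index [comp_intros]:
  assumes x: "computable B (\<lambda>z. x (fst (prod_decode z)) (snd (prod_decode z)))"
    and b: "computable B b" and N: "computable B N" and m: "computable B m"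
  shows "computable B (\<lambda>z. heap_index (b z) (N z) (m z) (x z))"
  unfolding heap_index_def radix_map_upt
  by (intro comp_intros computable_comp2[OF x] computable_comp[OF b] computable_comp[OF N]
      computable_comp[OF m])

lemma computable_heap_size [comp_intros]:
  assumes "computable B r"
  shows "computable B (\<lambda>x. heap_size k (r x))"
proof -
  have "rec_nat 1 (\<lambda>_ s. Suc (k * s)) i = heap_size k i" for i
    by (induction i) simp_all
  moreover have "computable B (\<lambda>x. rec_nat 1 (\<lambda>_ s. Suc (k * s)) (r x))"
    by (intro computable_rec comp_intros assms)
  ultimately show ?thesis by simp
qed

section \<open>Tiles recording a pair of configurations\<close>

definition rule_value :: "nat \<Rightarrow> nat \<Rightarrow> (nat \<Rightarrow> nat) \<Rightarrow> nat" where
  "rule_value k code x =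
    table_value (ca_states code) (snd (prod_decode (snd (prod_decode (snd (prod_decode code))))))
      (heap_index (Suc (ca_cap code)) (heap_size k (ca_radius code)) (ca_states code) x)"

text \<open>A tile records the states of two configurations along all words of length at most the radius:
  its base m * m digit at heap position j is x + m * y.\<close>

definition tile_digit :: "nat \<Rightarrow> nat \<Rightarrow> nat \<Rightarrow> nat" where
  "tile_digit m t j = t div (m * m) ^ j mod (m * m)"

definition fst_state :: "nat \<Rightarrow> nat \<Rightarrow> nat \<Rightarrow> nat" where
  "fst_state m t j = tile_digit m t j mod m"

definition snd_state :: "nat \<Rightarrow> nat \<Rightarrow> nat \<Rightarrow> nat" where
  "snd_state m t j = tile_digit m t j div m"

definition tile_ok :: "nat \<Rightarrow> nat \<Rightarrow> nat \<Rightarrow> bool" where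
  "tile_ok k code t \<longleftrightarrow>
     rule_value k code (fst_state (ca_states code) t) = fst_state (ca_states code) t 0 \<and>
     rule_value k code (snd_state (ca_states code) t) = fst_state (ca_states code) t 0"

text \<open>Consistency is asked of the source tile only; as soon as there is a generator, every
  vertex is the source of an edge.\<close>

definition compatible :: "nat \<Rightarrow> nat \<Rightarrow> nat \<Rightarrow> nat \<Rightarrow> nat \<Rightarrow> bool" where
  "compatible k code i t t' \<longleftrightarrow> tile_ok k code t \<and>
     (\<forall>j<heap_size k (ca_radius code). Suc (k * j + i) < heap_size k (ca_radius code) \<longrightarrow>
        tile_digit (ca_states code) t (Suc (k * j + i)) = tile_digit (ca_states code) t' j)"

definition tile_count :: "nat \<Rightarrow> nat \<Rightarrow> nat" where
  "tile_count k code = (ca_states code * ca_states code) ^ heap_size k (ca_radius code)"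

text \<open>The list has one entry for each pair of tiles. A forbidden pair is overwritten by a
  dummy whose components equal the number of tiles, so no tiling can use it.\<close>

definition ca_domino :: "nat \<Rightarrow> nat \<Rightarrow> nat" where
  "ca_domino k code = list_encode (map (\<lambda>i. list_encode (map (\<lambda>p.
     if compatible k code i (p div tile_count k code) (p mod tile_count k code)
     then prod_encode (p div tile_count k code, p mod tile_count k code)
     else prod_encode (tile_count k code, tile_count k code))
     [0..<tile_count k code * tile_count k code])) [0..<k])"

lemma computable_rule_value [comp_intros]:
  assumes x: "computable B (\<lambda>z. x (fst (prod_decode z)) (snd (prod_decode z)))"
    and code: "computable B code"
  shows "computable B (\<lambda>z. rule_value k (code z) (x z))"
  unfolding rule_value_def table_value_def ca_states_def ca_cap_def ca_radius_def
  by (intro comp_intros computable_comp2[OF x] computable_comp[OF code])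

lemma computable_tile_digit [comp_intros]:
  "computable B m \<Longrightarrow> computable B t \<Longrightarrow> computable B j \<Longrightarrow> computable B (\<lambda>x. tile_digit (m x) (t x) (j x))"
  unfolding tile_digit_def by (intro comp_intros)

lemma computable_ca_states [comp_intros]: "computable B f \<Longrightarrow> computable B (\<lambda>x. ca_states (f x))"
  unfolding ca_states_def by (intro comp_intros)

lemma computable_tile_count [comp_intros]:
  "computable B code \<Longrightarrow> computable B (\<lambda>x. tile_count k (code x))"
  unfolding tile_count_def ca_radius_def by (intro comp_intros)

lemma decidable_tile_ok [comp_intros]:
  assumes "computable B code" "computable B t"
  shows "decidable B (\<lambda>x. tile_ok k (code x) (t x))"
  unfolding tile_ok_def fst_state_def snd_state_def
  by (intro comp_intros assms computable_comp[OF assms(1)] computable_comp[OF assms(2)])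

lemma decidable_compatible [comp_intros]:
  assumes "computable B code" "computable B i" "computable B t" "computable B t'"
  shows "decidable B (\<lambda>x. compatible k (code x) (i x) (t x) (t' x))"
  unfolding compatible_def ca_radius_def
  by (intro comp_intros assms computable_comp[OF assms(1)] computable_comp[OF assms(2)]
      computable_comp[OF assms(3)] computable_comp[OF assms(4)])

lemma computable_ca_domino [comp_intros]:
  assumes "computable B code"
  shows "computable B (\<lambda>x. ca_domino k (code x))"
  unfolding ca_domino_def by (intro comp_intros computable_comp[OF assms])

lemma ca_domino_iff:
  assumes i: "i < k" and t: "t < tile_count k code" "t' < tile_count k code"
  shows "(t, t') \<in> dom_D (ca_domino k code) i \<longleftrightarrow> compatible k code i t t'"
proof -
  let ?T = "tile_count k code"
  let ?e = "\<lambda>p. if compatible k code i (p div ?T) (p mod ?T)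
     then prod_encode (p div ?T, p mod ?T) else prod_encode (?T, ?T)"
  have "dom_D (ca_domino k code) i = (prod_decode \<circ> ?e) ` {0..<?T * ?T}"
    using i by (simp add: dom_D_def ca_domino_def image_comp del: upt_Suc)
  then have "(t, t') \<in> dom_D (ca_domino k code) i \<longleftrightarrow> (\<exists>p<?T * ?T. (t, t') = prod_decode (?e p))"
    by (auto simp: image_iff)
  also have "\<dots> \<longleftrightarrow> (\<exists>p<?T * ?T. compatible k code i (p div ?T) (p mod ?T) \<and> p div ?T = t \<and> p mod ?T = t')"
    using t by auto
  also have "\<dots> \<longleftrightarrow> compatible k code i t t'"
  proof
    assume *: "compatible k code i t t'"
    have "t * ?T + t' < Suc t * ?T" using t by simp
    also have "\<dots> \<le> ?T * ?T" using t by (intro mult_le_mono1) simp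
    finally have "t * ?T + t' < ?T * ?T" .
    moreover have "(t * ?T + t') div ?T = t" "(t * ?T + t') mod ?T = t'" using t by simp_all
    ultimately show "\<exists>p<?T * ?T. compatible k code i (p div ?T) (p mod ?T) \<and> p div ?T = t \<and> p mod ?T = t'"
      using * by metis
  qed auto
  finally show ?thesis .
qed

lemma heap_size_pos: "0 < heap_size k r"
  by (cases r) simp_all

definition tile_of :: "nat \<Rightarrow> nat \<Rightarrow> (nat \<Rightarrow> nat) \<Rightarrow> (nat \<Rightarrow> nat) \<Rightarrow> nat" where
  "tile_of m N x y = radix (m * m) (map (\<lambda>j. x j + m * y j) [0..<N])"

lemma tile_of:
  assumes "\<And>j. j < N \<Longrightarrow> x j < m" "\<And>j. j < N \<Longrightarrow> y j < m"
  shows "tile_of m N x y < (m * m) ^ N"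
    and "j < N \<Longrightarrow> tile_digit m (tile_of m N x y) j = x j + m * y j"
    and "j < N \<Longrightarrow> fst_state m (tile_of m N x y) j = x j"
    and "j < N \<Longrightarrow> snd_state m (tile_of m N x y) j = y j"
proof -
  have "x j + m * y j < m * m" if "j < N" for j
  proof -
    have "x j + m * y j < m * Suc (y j)" using assms(1)[OF that] by simp
    also have "\<dots> \<le> m * m" using assms(2)[OF that] by (intro mult_le_mono2) simp
    finally show ?thesis .
  qed
  then have *: "set (map (\<lambda>j. x j + m * y j) [0..<N]) \<subseteq> {..<m * m}" by auto
  show "tile_of m N x y < (m * m) ^ N"
    using radix_less[OF *] by (simp add: tile_of_def)
  assume j: "j < N"
  show digit: "tile_digit m (tile_of m N x y) j = x j + m * y j"
    using radix_digit[OF *, of j] j by (simp add: tile_of_def tile_digit_def)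
  show "fst_state m (tile_of m N x y) j = x j" "snd_state m (tile_of m N x y) j = y j"
    using assms[OF j] by (simp_all add: fst_state_def snd_state_def digit)
qed

section \<open>Correspondence between orbits and tilings\<close>

context cayley_graph
begin

lemma ca_global_rule_value:
  "v \<in> carrier G \<Longrightarrow> ca_global G gens code c v = rule_value deg code (\<lambda>j. c (heap_walk v j))"
  unfolding rule_value_def by (rule ca_global_heap)

lemma rule_value_cong:
  "(\<And>j. j < heap_size k (ca_radius code) \<Longrightarrow> x j = y j) \<Longrightarrow> rule_value k code x = rule_value k code y"
  unfolding rule_value_def using heap_index_cong by metis

abbreviation ca_tiling :: "nat \<Rightarrow> ('a \<Rightarrow> nat) \<Rightarrow> bool" where
  "ca_tiling code \<equiv> domino_valid G gens (tile_count deg code) (dom_D (ca_domino deg code))"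

lemma ca_tiling_iff:
  "ca_tiling code c \<longleftrightarrow> (\<forall>v\<in>carrier G. c v < tile_count deg code) \<and>
     (\<forall>v\<in>carrier G. \<forall>i<deg. compatible deg code i (c v) (c (step v i)))"
  by (auto simp: domino_valid_iff ca_domino_iff step_closed)

text \<open>The tile at v reads off both configurations along all words from v. Adjacent tiles then
  overlap correctly by \<open>heap_walk_child\<close>, and consistency restates that both
  configurations are mapped to x.\<close>

lemma orbit_tiling:
  assumes x: "x \<in> ca_configs G (ca_states code)" and y: "y \<in> ca_configs G (ca_states code)"
    and Fx: "ca_global G gens code x = x" and Fy: "ca_global G gens code y = x"
  obtains c where "ca_tiling code c" "\<And>v. v \<in> carrier G \<Longrightarrow> tile_ok deg code (c v)"
    "\<And>v. v \<in> carrier G \<Longrightarrow> fst_state (ca_states code) (c v) 0 = x v"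
    "\<And>v. v \<in> carrier G \<Longrightarrow> snd_state (ca_states code) (c v) 0 = y v"
proof -
  let ?m = "ca_states code" and ?N = "heap_size deg (ca_radius code)"
  define c where "c v = tile_of ?m ?N (\<lambda>j. x (heap_walk v j)) (\<lambda>j. y (heap_walk v j))" for v
  have bnd: "x (heap_walk v j) < ?m" "y (heap_walk v j) < ?m" if "v \<in> carrier G" "j < ?N" for v j
    using x y reach_heap(2)[OF that] by (simp_all add: ca_configs_def)
  have T: "c v < (?m * ?m) ^ ?N"
    "\<And>j. j < ?N \<Longrightarrow> tile_digit ?m (c v) j = x (heap_walk v j) + ?m * y (heap_walk v j)"
    "\<And>j. j < ?N \<Longrightarrow> fst_state ?m (c v) j = x (heap_walk v j)"
    "\<And>j. j < ?N \<Longrightarrow> snd_state ?m (c v) j = y (heap_walk v j)" if "v \<in> carrier G" for v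
    unfolding c_def using tile_of[of ?N "\<lambda>j. x (heap_walk v j)" ?m "\<lambda>j. y (heap_walk v j)"] bnd[OF that]
    by blast+
  have ok: "tile_ok deg code (c v)" if v: "v \<in> carrier G" for v
  proof -
    have "rule_value deg code (fst_state ?m (c v)) = ca_global G gens code x v"
      "rule_value deg code (snd_state ?m (c v)) = ca_global G gens code y v"
      unfolding ca_global_rule_value[OF v] by (auto intro!: rule_value_cong simp: T[OF v])
    then show ?thesis
      unfolding tile_ok_def Fx Fy using T(3)[OF v heap_size_pos] by simp
  qed
  have "ca_tiling code c"
    unfolding ca_tiling_iff
  proof (intro conjI ballI allI impI)
    fix v assume v: "v \<in> carrier G"
    show "c v < tile_count deg code" using T(1)[OF v] by (simp add: tile_count_def)
    fix i assume i: "i < deg"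
    show "compatible deg code i (c v) (c (step v i))"
      unfolding compatible_def using ok[OF v] T(2)[OF v]
        T(2)[OF step_closed[OF v i]] heap_walk_child[OF i] by simp
  qed
  then show ?thesis
    by (rule that) (use ok T(3,4) heap_size_pos in auto)
qed

lemma tiling_orbit:
  assumes c: "ca_tiling code c" and ok: "\<forall>v\<in>carrier G. tile_ok deg code (c v)"
  obtains x y where "x \<in> ca_configs G (ca_states code)" "y \<in> ca_configs G (ca_states code)"
    "ca_global G gens code x = x" "ca_global G gens code y = x"
    "\<forall>v\<in>carrier G. x v = fst_state (ca_states code) (c v) 0"
    "\<forall>v\<in>carrier G. y v = snd_state (ca_states code) (c v) 0"
proof -
  let ?m = "ca_states code" and ?N = "heap_size deg (ca_radius code)"
  define x where "x v = (if v \<in> carrier G then fst_state ?m (c v) 0 else 0)" for v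
  define y where "y v = (if v \<in> carrier G then snd_state ?m (c v) 0 else 0)" for v
  have m: "0 < ?m" by (simp add: ca_states_def)
  \<comment> \<open>Overlap lets an entry be fetched from a neighbour at a smaller heap position;
    repeating this along the word ends at position 0 of the tile at its end vertex.\<close>
  have digit: "tile_digit ?m (c v) j = tile_digit ?m (c (heap_walk v j)) 0"
    if "j < ?N" "v \<in> carrier G" for v j
    using that
  proof (induction j arbitrary: v rule: less_induct)
    case (less j)
    show ?case
    proof (cases j)
      case (Suc q)
      \<comment> \<open>Without generators the heap has the single position 0, so a successor
        position yields a generator.\<close>
      have "0 < deg"
        using less.prems(1) Suc by (cases "ca_radius code"; cases "deg = 0") auto
      then have i: "q mod deg < deg" and q: "Suc (deg * (q div deg) + q mod deg) = j"
        using Suc by simp_all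
      have q': "q div deg < j" using Suc by (simp add: le_imp_less_Suc)
      then have "q div deg < ?N" using less.prems(1) by simp
      moreover have "compatible deg code (q mod deg) (c v) (c (step v (q mod deg)))"
        using c i less.prems(2) by (simp add: ca_tiling_iff)
      ultimately have "tile_digit ?m (c v) j = tile_digit ?m (c (step v (q mod deg))) (q div deg)"
        using less.prems(1) q unfolding compatible_def by metis
      also have "\<dots> = tile_digit ?m (c (heap_walk (step v (q mod deg)) (q div deg))) 0"
        using less.IH[OF q' _ step_closed[OF less.prems(2) i]] q' less.prems(1) by simp
      also have "heap_walk (step v (q mod deg)) (q div deg) = heap_walk v j"
        using heap_walk_child[OF i, of v "q div deg"] unfolding q by simp
      finally show ?thesis .
    qed simp
  qed
  have x: "x (heap_walk v j) = fst_state ?m (c v) j" and y: "y (heap_walk v j) = snd_state ?m (c v) j"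
    if "j < ?N" "v \<in> carrier G" for v j
    unfolding x_def y_def fst_state_def snd_state_def digit[OF that]
    using reach_heap(2)[OF that(2,1)] by simp_all
  have F: "ca_global G gens code x v = x v" "ca_global G gens code y v = x v" for v
  proof -
    show "ca_global G gens code x v = x v"
    proof (cases "v \<in> carrier G")
      case True
      have "ca_global G gens code x v = rule_value deg code (fst_state ?m (c v))"
        unfolding ca_global_rule_value[OF True]
        by (intro rule_value_cong) (simp add: x True)
      then show ?thesis using ok True by (simp add: tile_ok_def x_def)
    qed (simp add: ca_global_def x_def)
    show "ca_global G gens code y v = x v"
    proof (cases "v \<in> carrier G")
      case True
      have "ca_global G gens code y v = rule_value deg code (snd_state ?m (c v))"
        unfolding ca_global_rule_value[OF True]
        by (intro rule_value_cong) (simp add: y True)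
      then show ?thesis using ok True by (simp add: tile_ok_def x_def)
    qed (simp add: ca_global_def x_def)
  qed
  have "snd_state ?m t 0 < ?m" for t
    using m by (simp add: snd_state_def tile_digit_def less_mult_imp_div_less)
  then have "x \<in> ca_configs G ?m" "y \<in> ca_configs G ?m"
    using m by (auto simp: ca_configs_def x_def y_def fst_state_def)
  then show ?thesis
    by (rule that) (use F in \<open>auto simp: x_def y_def\<close>)
qed

section \<open>Automata problems decided by domino oracles\<close>

lemma carrier_deg_0: "deg = 0 \<Longrightarrow> carrier G = {\<one>\<^bsub>G\<^esub>}"
  using cayley generate_empty by (simp add: is_cayley_graph_def)

text \<open>Without generators the domino specification imposes nothing; the rule is then enforced by
  requiring some occurring tile to be consistent with it.\<close>

lemma tile_ok_everywhere:
  assumes "ca_tiling code c" "v \<in> carrier G" "tile_ok deg code (c v)" "u \<in> carrier G"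
  shows "tile_ok deg code (c u)"
proof (cases "deg = 0")
  case True
  then show ?thesis using carrier_deg_0 assms by auto
next
  case False
  then show ?thesis using assms by (auto simp: ca_tiling_iff compatible_def)
qed

text \<open>A fixed point x is tiled as the pair (x, x). The tile \<open>t\<close> handles the group
  without generators, where the constant tiling by \<open>t\<close> yields a fixed point; with a
  generator, \<open>compatible\<close> itself forces consistency.\<close>

lemma ca_fixpoint_iff:
  "code \<in> ca_fixpoint_set G gens \<longleftrightarrow> (\<exists>t<tile_count deg code. tile_ok deg code t \<and>
     prod_encode (tile_count deg code, ca_domino deg code) \<in> domino_problem G gens)" (is "?L \<longleftrightarrow> ?R")
proof
  assume ?L
  then obtain x where "x \<in> ca_configs G (ca_states code)" "ca_global G gens code x = x"
    unfolding ca_fixpoint_set_def by blast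
  then obtain c where "ca_tiling code c" "\<And>v. v \<in> carrier G \<Longrightarrow> tile_ok deg code (c v)"
    using orbit_tiling[of x code x] by metis
  moreover from this have "c \<one>\<^bsub>G\<^esub> < tile_count deg code" by (simp add: domino_valid_iff)
  ultimately show ?R by (auto simp: domino_problem_def)
next
  assume ?R
  then obtain t c where t: "t < tile_count deg code" "tile_ok deg code t" and c: "ca_tiling code c"
    by (auto simp: domino_problem_def)
  obtain c' where "ca_tiling code c'" "\<forall>v\<in>carrier G. tile_ok deg code (c' v)"
  proof (cases "deg = 0")
    case True
    then have "ca_tiling code (\<lambda>_. t)" unfolding ca_tiling_iff using t by simp
    then show ?thesis using that t(2) by blast
  next
    case False
    then have "\<forall>v\<in>carrier G. tile_ok deg code (c v)"
      using c unfolding ca_tiling_iff compatible_def by blast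
    then show ?thesis using that[OF c] by blast
  qed
  from tiling_orbit[OF this] show ?L
    unfolding ca_fixpoint_set_def by blast
qed

text \<open>The seed \<open>t\<close> is the tile at a vertex where the configurations differ. In
  the other direction its occurrence provides both the difference and, by
  \<open>tile_ok_everywhere\<close>, consistency of all tiles.\<close>

lemma ca_preimage_iff:
  "code \<in> ca_preimage_set G gens \<longleftrightarrow> (\<exists>t<tile_count deg code. tile_ok deg code t \<and>
     fst_state (ca_states code) t 0 \<noteq> snd_state (ca_states code) t 0 \<and>
     prod_encode (tile_count deg code, prod_encode (ca_domino deg code, t)) \<in> seeded_domino_problem G gens)"
    (is "?L \<longleftrightarrow> ?R")
proof
  assume ?L
  then obtain x y where xy: "x \<in> ca_configs G (ca_states code)" "y \<in> ca_configs G (ca_states code)"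
    "ca_global G gens code x = x" "ca_global G gens code y = x" "x \<noteq> y"
    unfolding ca_preimage_set_def by blast
  obtain v where "x v \<noteq> y v" using xy(5) by blast
  moreover from this have v: "v \<in> carrier G" using xy(1,2) by (force simp: ca_configs_def)
  moreover obtain c where c: "ca_tiling code c" "\<And>v. v \<in> carrier G \<Longrightarrow> tile_ok deg code (c v)"
    "\<And>v. v \<in> carrier G \<Longrightarrow> fst_state (ca_states code) (c v) 0 = x v"
    "\<And>v. v \<in> carrier G \<Longrightarrow> snd_state (ca_states code) (c v) 0 = y v"
    using orbit_tiling[OF xy(1-4)] by metis
  moreover have "c v < tile_count deg code" using c(1) v by (simp add: domino_valid_iff)
  ultimately show ?R
    by (intro exI[of _ "c v"]) (auto simp: seeded_domino_problem_def)
next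
  assume ?R
  then obtain t c v where t: "tile_ok deg code t" "fst_state (ca_states code) t 0 \<noteq> snd_state (ca_states code) t 0"
    and c: "ca_tiling code c" "v \<in> carrier G" "c v = t"
    by (auto simp: seeded_domino_problem_def)
  have ok: "\<forall>u\<in>carrier G. tile_ok deg code (c u)"
    using tile_ok_everywhere[OF c(1,2)] c(3) t(1) by simp
  obtain x y where xy: "x \<in> ca_configs G (ca_states code)" "y \<in> ca_configs G (ca_states code)"
    "ca_global G gens code x = x" "ca_global G gens code y = x"
    "\<forall>v\<in>carrier G. x v = fst_state (ca_states code) (c v) 0"
    "\<forall>v\<in>carrier G. y v = snd_state (ca_states code) (c v) 0"
    using tiling_orbit[OF c(1) ok] by blast
  have "x v \<noteq> y v" using xy(5,6) c(2,3) t(2) by simp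
  then have "x \<noteq> y" by blast
  then show ?L
    unfolding ca_preimage_set_def using xy(1-4) by blast
qed

lemma ca_inf_preimage_iff:
  "code \<in> ca_inf_preimage_set G gens \<longleftrightarrow> (\<exists>t<tile_count deg code. tile_ok deg code t \<and>
     fst_state (ca_states code) t 0 \<noteq> snd_state (ca_states code) t 0 \<and>
     prod_encode (tile_count deg code, prod_encode (ca_domino deg code, t)) \<in> recurring_domino_problem G gens)"
    (is "?L \<longleftrightarrow> ?R")
proof
  assume ?L
  then obtain x y where xy: "x \<in> ca_configs G (ca_states code)" "y \<in> ca_configs G (ca_states code)"
    "ca_global G gens code x = x" "ca_global G gens code y = x" and inf: "infinite {v. x v \<noteq> y v}"
    unfolding ca_inf_preimage_set_def by blast
  have sub: "v \<in> carrier G" if "x v \<noteq> y v" for v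
    using that xy(1,2) by (force simp: ca_configs_def)
  obtain c where c: "ca_tiling code c" "\<And>v. v \<in> carrier G \<Longrightarrow> tile_ok deg code (c v)"
    "\<And>v. v \<in> carrier G \<Longrightarrow> fst_state (ca_states code) (c v) 0 = x v"
    "\<And>v. v \<in> carrier G \<Longrightarrow> snd_state (ca_states code) (c v) 0 = y v"
    using orbit_tiling[OF xy] by metis
  \<comment> \<open>Infinitely many differences meet only finitely many tiles, so by the pigeonhole
    principle one tile is used at infinitely many of them.\<close>
  have "c ` {v. x v \<noteq> y v} \<subseteq> {..<tile_count deg code}"
    using c(1) sub by (auto simp: domino_valid_iff)
  then have "finite (c ` {v. x v \<noteq> y v})" using finite_subset by blast
  from pigeonhole_infinite[OF inf this] obtain v
    where v: "x v \<noteq> y v" and inf': "infinite {u \<in> {v. x v \<noteq> y v}. c u = c v}" by blast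
  have "{u \<in> {v. x v \<noteq> y v}. c u = c v} \<subseteq> {u \<in> carrier G. c u = c v}" using sub by blast
  then have "infinite {u \<in> carrier G. c u = c v}" using inf' finite_subset by blast
  moreover have "c v < tile_count deg code" using c(1) sub[OF v] by (simp add: domino_valid_iff)
  ultimately show ?R
    using c sub[OF v] v by (intro exI[of _ "c v"]) (auto simp: recurring_domino_problem_def)
next
  assume ?R
  then obtain t c where t: "tile_ok deg code t" "fst_state (ca_states code) t 0 \<noteq> snd_state (ca_states code) t 0"
    and c: "ca_tiling code c" "infinite {v \<in> carrier G. c v = t}"
    by (auto simp: recurring_domino_problem_def)
  from infinite_imp_nonempty[OF c(2)] obtain v where v: "v \<in> carrier G" "c v = t" by blast
  have ok: "\<forall>u\<in>carrier G. tile_ok deg code (c u)"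
    using tile_ok_everywhere[OF c(1) v(1)] v(2) t(1) by simp
  obtain x y where xy: "x \<in> ca_configs G (ca_states code)" "y \<in> ca_configs G (ca_states code)"
    "ca_global G gens code x = x" "ca_global G gens code y = x"
    "\<forall>v\<in>carrier G. x v = fst_state (ca_states code) (c v) 0"
    "\<forall>v\<in>carrier G. y v = snd_state (ca_states code) (c v) 0"
    using tiling_orbit[OF c(1) ok] by blast
  have "{v \<in> carrier G. c v = t} \<subseteq> {v. x v \<noteq> y v}" using xy(5,6) t(2) by auto
  then have "infinite {v. x v \<noteq> y v}" using c(2) finite_subset by blast
  then show ?L
    unfolding ca_inf_preimage_set_def using xy(1-4) by blast
qed

text \<open>The three equivalences are bounded searches over tiles with an oracle query in the body;
  \<open>deg\<close> enters as a constant.\<close>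

lemma ca_problems_reduce:
  "turing_reducible (ca_fixpoint_set G gens) (domino_problem G gens)"
  "turing_reducible (ca_preimage_set G gens) (seeded_domino_problem G gens)"
  "turing_reducible (ca_inf_preimage_set G gens) (recurring_domino_problem G gens)"
  unfolding turing_reducible_iff_decidable ca_fixpoint_iff ca_preimage_iff ca_inf_preimage_iff
    fst_state_def snd_state_def
  by (intro comp_intros)+

end

theorem mainTheorem11:
  fixes G :: "('a, 'b) monoid_scheme" and gens :: "'a list"
  assumes "is_cayley_graph G gens"
  shows "turing_equivalent (domino_problem G gens) (ca_fixpoint_set G gens)
       \<and> turing_equivalent (seeded_domino_problem G gens) (ca_preimage_set G gens)
       \<and> turing_equivalent (recurring_domino_problem G gens) (ca_inf_preimage_set G gens)"
proof -
  interpret cayley_graph G gens by (unfold_locales) (rule assms)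
  show ?thesis
    unfolding turing_equivalent_def using domino_problems_reduce ca_problems_reduce by blast
qed

end
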